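(* Let $G$ be a finite simple graph and let $H$ be a bipartite subgraph of $G$. If $E(H)$ is a clique in $L(G)^2$, then $$|E(H)|\le \frac{620}{1987}\,\sigma_G(H)^2.$$
   Context: All graphs are finite and simple. $L(G)$ denotes the line graph of $G$: its vertices are the edges of $G$, two being adjacent when they share an endpoint. For a positive integer $k$, the $k$-th power $F^k$ of a graph $F$ has vertex set $V(F)$, and two distinct vertices are adjacent in $F^k$ if and only if they are at distance at most $k$ in $F$. Thus $L(G)^2$ is the square of the line graph of $G$, and a set of edges of $G$ is a clique in $L(G)^2$ if any two distinct edges in the set are adjacent in $L(G)^2$ (distances are measured in $L(G)$, not in $L(H)$). The subgraph $H$ of $G$ need not be induced. For a subgraph $H$ of $G$ with at least one edge, the Ore-degree of $H$ in $G$ is $$\sigma_G(H):=\max_{xy\in E(H)}\bigl(\deg_G(x)+\deg_G(y)\bigr),$$ and $\sigma_G(H):=0$ if $H$ has no edges. *)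

theory Defs
  imports Complex_Main "HOL-Library.Extended_Nat"
begin

text \<open>Edges are unordered pairs, so an edge of a simple graph is a two-element set of vertices.\<close>

record 'a sgraph =
  gverts :: "'a set"
  gedges :: "'a set set"

definition finite_simple_graph :: "'a sgraph \<Rightarrow> bool" where
  "finite_simple_graph G \<longleftrightarrow>
     finite (gverts G) \<and>
     (\<forall>e \<in> gedges G. \<exists>x \<in> gverts G. \<exists>y \<in> gverts G. x \<noteq> y \<and> e = {x, y})"

definition adjacent :: "'a sgraph \<Rightarrow> 'a \<Rightarrow> 'a \<Rightarrow> bool" where
  "adjacent G x y \<longleftrightarrow> {x, y} \<in> gedges G"

definition vertex_degree :: "'a sgraph \<Rightarrow> 'a \<Rightarrow> nat" where
  "vertex_degree G x = card {y \<in> gverts G. adjacent G x y}"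

definition is_subgraph :: "'a sgraph \<Rightarrow> 'a sgraph \<Rightarrow> bool" where
  "is_subgraph H G \<longleftrightarrow>
     finite_simple_graph H \<and> gverts H \<subseteq> gverts G \<and> gedges H \<subseteq> gedges G"

definition bipartite_graph :: "'a sgraph \<Rightarrow> bool" where
  "bipartite_graph H \<longleftrightarrow>
     (\<exists>A B. A \<union> B = gverts H \<and> A \<inter> B = {} \<and>
        (\<forall>e \<in> gedges H. \<exists>a \<in> A. \<exists>b \<in> B. e = {a, b}))"

definition is_clique :: "'a sgraph \<Rightarrow> 'a set \<Rightarrow> bool" where
  "is_clique F S \<longleftrightarrow>
     S \<subseteq> gverts F \<and> (\<forall>x \<in> S. \<forall>y \<in> S. x \<noteq> y \<longrightarrow> adjacent F x y)"

definition line_graph :: "'a sgraph \<Rightarrow> 'a set sgraph" where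
  "line_graph G =
     \<lparr> gverts = gedges G,
       gedges = {{e, f} | e f. e \<in> gedges G \<and> f \<in> gedges G \<and> e \<noteq> f \<and> e \<inter> f \<noteq> {}} \<rparr>"

text \<open>A walk is the nonempty list of its vertices; its length is the number of its steps.\<close>

definition is_walk :: "'a sgraph \<Rightarrow> 'a \<Rightarrow> 'a list \<Rightarrow> 'a \<Rightarrow> bool" where
  "is_walk G x p y \<longleftrightarrow>
     p \<noteq> [] \<and> hd p = x \<and> last p = y \<and> set p \<subseteq> gverts G \<and>
     (\<forall>i. Suc i < length p \<longrightarrow> adjacent G (p ! i) (p ! Suc i))"

text \<open>The infimum of the empty set is \<open>\<infinity>\<close>: vertices in different components are at
  infinite distance.\<close>

definition graph_dist :: "'a sgraph \<Rightarrow> 'a \<Rightarrow> 'a \<Rightarrow> enat" where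
  "graph_dist G x y = (INF p \<in> {p. is_walk G x p y}. enat (length p - 1))"

definition graph_power :: "'a sgraph \<Rightarrow> nat \<Rightarrow> 'a sgraph" where
  "graph_power F k =
     \<lparr> gverts = gverts F,
       gedges = {{x, y} | x y. x \<in> gverts F \<and> y \<in> gverts F \<and> x \<noteq> y \<and>
                   graph_dist F x y \<le> enat k} \<rparr>"

text \<open>The degrees are taken in \<open>G\<close>, while the edges range over \<open>H\<close> only.\<close>

definition ore_degree :: "'a sgraph \<Rightarrow> 'a sgraph \<Rightarrow> nat" where
  "ore_degree G H =
     (if gedges H = {} then 0
      else Max {vertex_degree G x + vertex_degree G y | x y. {x, y} \<in> gedges H})"

end

theory Submission
  imports Defs
begin

text \<open>
  Write \<open>h\<close> for degrees in \<open>H\<close>, \<open>d\<close> for degrees in \<open>G\<close>, \<open>S\<close> for the Ore-degree and \<open>c = 620/1987\<close>.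

  Two reductions come first. If some edge of \<open>H\<close> has \<open>h(x) + h(y) < 2 c S\<close>, delete \<open>x\<close> and \<open>y\<close>
  from the graph. Every remaining edge of \<open>H\<close> is joined to \<open>xy\<close> by an edge of \<open>G\<close>, so \<open>S\<close> drops
  by at least one, while \<open>|H|\<close> drops by less than the derivative \<open>2 c S\<close> of \<open>c S\<^sup>2\<close>. Hence only
  graphs all of whose \<open>H\<close>-edges are heavy, \<open>h(x) + h(y) \<ge> 2 c S\<close>, need a proof. The discrete
  derivative costs an error linear in \<open>S\<close> (\<open>card_le_with_linear_error\<close>); replacing each
  vertex by \<open>k\<close> independent copies multiplies \<open>|H|\<close> by \<open>k\<^sup>2\<close> and \<open>S\<close> by \<open>k\<close>, and letting \<open>k\<close> grow
  removes the error (\<open>card_strong_pairs_le\<close>).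

  In the heavy case let \<open>A\<close>, \<open>B\<close> be the two sides, \<open>a0\<close> a vertex of largest \<open>H\<close>-degree \<open>\<alpha>\<close>, say in
  \<open>A\<close>, and \<open>b0\<close> an \<open>H\<close>-neighbour of \<open>a0\<close> of largest \<open>H\<close>-degree \<open>q\<close> among these. Every edge of \<open>H\<close>
  meets a \<open>G\<close>-neighbour of \<open>a0\<close> or \<open>b0\<close>. The neighbours that are not \<open>H\<close>-neighbours carry at most
  \<open>\<alpha>\<close> edges each, which gives \<open>|H| \<le> \<alpha> (d(a0) + d(b0) - \<alpha>) + X\<close>
  with an excess \<open>X = \<Sum>u(a) + \<Sum>v(b) - |N| - |M|\<close> (\<open>card_H_le_excess\<close>). Here \<open>a\<close> runs
  over the \<open>H\<close>-neighbours of \<open>b0\<close> and \<open>b\<close> over those of \<open>a0\<close>, \<open>u(a)\<close> and \<open>v(b)\<close> count the \<open>H\<close>-edges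
  that leave this rectangle, \<open>N\<close> is the set of pairs \<open>(a,b)\<close> not adjacent in \<open>G\<close> and \<open>M\<close> the set of
  pairs that are adjacent in \<open>G\<close> only.

  Maximality bounds \<open>u(a)\<close> by the number of non-edges of \<open>H\<close> at \<open>a\<close>. More important, a pair
  \<open>(a,b)\<close> in \<open>N\<close> forces \<open>a\<close> to be adjacent in \<open>G\<close> to all the \<open>v(b)\<close> vertices of \<open>A\<close> that the edges
  leaving at \<open>b\<close> reach, because \<open>a b0\<close> must be joined to each of these edges; this uses up degree of
  \<open>a\<close>, and the Ore condition for \<open>a b0\<close> becomes a bound on \<open>u(a) + v(b)\<close>. Heaviness makes
  the number of \<open>N\<close>-pairs at a vertex at most \<open>w S\<close> with \<open>w = 1 - 2 c\<close>. These facts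
  are collected in \<open>side_facts\<close>; they form a linear programme for \<open>X\<close>, which
  \<open>pair_excess_bound\<close> bounds through an explicit dual solution with one free parameter \<open>\<theta>\<close>.
  For the right \<open>\<theta>\<close> the total is at most \<open>c S\<^sup>2\<close> (\<open>optimal_threshold\<close>).
\<close>

section \<open>Bounding the excess by linear programming duality\<close>

lemma sum_card_slices:
  assumes "finite Q" "finite P" "N \<subseteq> Q \<times> P"
  shows "(\<Sum>a\<in>Q. card {b. (a,b) \<in> N}) = card N"
    and "(\<Sum>b\<in>P. card {a. (a,b) \<in> N}) = card N"
proof -
  have fin: "finite N" using assms by (meson finite_SigmaI finite_subset)
  have N1: "N = (SIGMA a:Q. {b. (a,b) \<in> N})" using assms by auto
  have "card (SIGMA a:Q. {b. (a,b) \<in> N}) = (\<Sum>a\<in>Q. card {b. (a,b) \<in> N})"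
    by (rule card_SigmaI) (use assms in \<open>auto intro: finite_subset[OF _ assms(2)]\<close>)
  then show "(\<Sum>a\<in>Q. card {b. (a,b) \<in> N}) = card N" using N1 by simp
  have N2: "prod.swap ` N = (SIGMA b:P. {a. (a,b) \<in> N})" using assms by force
  have "card (SIGMA b:P. {a. (a,b) \<in> N}) = (\<Sum>b\<in>P. card {a. (a,b) \<in> N})"
    by (rule card_SigmaI) (use assms in \<open>auto intro: finite_subset[OF _ assms(1)]\<close>)
  moreover have "card (prod.swap ` N) = card N" by (rule card_image) (auto simp: inj_on_def)
  ultimately show "(\<Sum>b\<in>P. card {a. (a,b) \<in> N}) = card N" using N2 by simp
qed

lemma sum_over_slices:
  fixes f :: "'a \<Rightarrow> real" and g :: "'b \<Rightarrow> real"
  assumes "finite Q" "finite P" "N \<subseteq> Q \<times> P"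
  shows "(\<Sum>(a,b)\<in>N. f a) = (\<Sum>a\<in>Q. card {b. (a,b) \<in> N} * f a)"
    and "(\<Sum>(a,b)\<in>N. g b) = (\<Sum>b\<in>P. card {a. (a,b) \<in> N} * g b)"
proof -
  have N1: "N = (SIGMA a:Q. {b. (a,b) \<in> N})" using assms by auto
  have "(\<Sum>(a,b)\<in>(SIGMA a:Q. {b. (a,b) \<in> N}). f a) = (\<Sum>a\<in>Q. \<Sum>b\<in>{b. (a,b) \<in> N}. f a)"
    by (rule sum.Sigma[symmetric]) (use assms in \<open>auto intro: finite_subset[OF _ assms(2)]\<close>)
  then show "(\<Sum>(a,b)\<in>N. f a) = (\<Sum>a\<in>Q. card {b. (a,b) \<in> N} * f a)" using N1 by simp
  have N2: "prod.swap ` N = (SIGMA b:P. {a. (a,b) \<in> N})" using assms by force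
  have "(\<Sum>(b,a)\<in>(SIGMA b:P. {a. (a,b) \<in> N}). g b) = (\<Sum>b\<in>P. \<Sum>a\<in>{a. (a,b) \<in> N}. g b)"
    by (rule sum.Sigma[symmetric]) (use assms in \<open>auto intro: finite_subset[OF _ assms(1)]\<close>)
  moreover have "(\<Sum>(b,a)\<in>prod.swap ` N. g b) = (\<Sum>(a,b)\<in>N. g b)"
    by (subst sum.reindex) (auto simp: inj_on_def intro!: sum.cong)
  ultimately show "(\<Sum>(a,b)\<in>N. g b) = (\<Sum>b\<in>P. card {a. (a,b) \<in> N} * g b)" using N2 by simp
qed

text \<open>
  The part \<open>\<nu>/w\<close> of \<open>u\<close> is kept, to be charged later to the pairs in \<open>N\<close>. The rest, of weight
  \<open>1 - \<nu>/w\<close>, is bounded by \<open>\<nu> + m\<close> up to weight \<open>1 - \<theta>\<close> and by \<open>\<nu> + r\<close> beyond. Using weight at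
  most \<open>1 - \<theta>\<close> on one side and at most \<open>\<theta>\<close> on the other makes the total charge to a pair in
  \<open>M\<close> at most one.
\<close>

lemma split_at_threshold:
  fixes u \<nu> m r \<theta> w :: real
  assumes "0 < w" "0 \<le> \<nu>" "\<nu> \<le> w" "0 \<le> \<theta>" "\<theta> \<le> 1" "0 \<le> m"
    and um: "u \<le> \<nu> + m" and ur: "u \<le> \<nu> + r"
  shows "u \<le> \<nu> * u / w + (1 - \<nu> / w) * \<nu> + (1 - \<theta>) * m + r * max 0 (\<theta> - \<nu> / w)"
proof -
  define x1 where "x1 = min (1 - \<nu> / w) (1 - \<theta>)"
  define x2 where "x2 = max 0 (\<theta> - \<nu> / w)"
  have x: "x1 + x2 = 1 - \<nu> / w" by (auto simp: x1_def x2_def)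
  have "0 \<le> x1" using assms by (simp add: x1_def)
  have "0 \<le> x2" by (simp add: x2_def)
  have "x1 * u \<le> x1 * \<nu> + x1 * m" using mult_left_mono[OF um \<open>0 \<le> x1\<close>] by (simp add: algebra_simps)
  also have "x1 * m \<le> (1 - \<theta>) * m" using assms by (intro mult_right_mono) (auto simp: x1_def)
  finally have 1: "x1 * u \<le> x1 * \<nu> + (1 - \<theta>) * m" by simp
  have 2: "x2 * u \<le> x2 * \<nu> + r * x2" using mult_left_mono[OF ur \<open>0 \<le> x2\<close>] by (simp add: algebra_simps)
  have "u = \<nu> * u / w + (x1 + x2) * u" unfolding x by (simp add: algebra_simps)
  also have "\<dots> \<le> \<nu> * u / w + (x1 + x2) * \<nu> + (1 - \<theta>) * m + r * x2"
    using 1 2 by (simp add: algebra_simps)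
  finally show ?thesis using x by (simp add: x2_def)
qed

text \<open>
  Below and above the kink at \<open>\<nu> = \<theta> w\<close> the left-hand side is a concave parabola. The two
  parabolas have the same maximum, so the kink costs nothing.
\<close>

lemma peak_bound:
  fixes \<nu> r \<theta> w :: real
  assumes "0 < w"
  shows "\<theta> * \<nu> - \<nu>\<^sup>2 / (2 * w) + r * \<nu> / (2 * w) + r * max 0 (\<theta> - \<nu> / w)
         \<le> (2 * w * \<theta> + r)\<^sup>2 / (8 * w)"
proof (cases "\<theta> \<le> \<nu> / w")
  case True
  have "(2 * w * \<theta> + r)\<^sup>2 / (8 * w) - (\<theta> * \<nu> - \<nu>\<^sup>2 / (2 * w) + r * \<nu> / (2 * w))
        = (w * \<theta> + r / 2 - \<nu>)\<^sup>2 / (2 * w)"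
    using assms by (simp add: field_simps power2_eq_square)
  moreover have "\<dots> \<ge> 0" using assms by simp
  ultimately show ?thesis using True by simp
next
  case False
  have "(2 * w * \<theta> + r)\<^sup>2 / (8 * w) - (\<theta> * \<nu> - \<nu>\<^sup>2 / (2 * w) + r * \<nu> / (2 * w) + r * (\<theta> - \<nu> / w))
        = (w * \<theta> - \<nu> - r / 2)\<^sup>2 / (2 * w)"
    using assms by (simp add: field_simps power2_eq_square)
  moreover have "\<dots> \<ge> 0" using assms by simp
  ultimately show ?thesis using False by simp
qed

text \<open>
  Each pair in \<open>N\<close> gets weight \<open>1/(2w)\<close> for \<open>uvr\<close> and the same weight for \<open>uvs\<close>. This is
  admissible since a point lies in at most \<open>w\<close> pairs. Because the weight is
  constant, \<open>N\<close> enters the final estimate only through its slices, and that estimate decouples into one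
  function of the slice size for each point, however unevenly \<open>N\<close> is spread.
\<close>

lemma pair_excess_bound:
  fixes u :: "'a \<Rightarrow> real" and v :: "'b \<Rightarrow> real" and r s w \<theta> :: real
    and N M :: "('a \<times> 'b) set"
    and \<nu> :: "'a \<Rightarrow> real" and \<mu> :: "'b \<Rightarrow> real"
  defines "\<nu> \<equiv> \<lambda>a. real (card {b. (a,b) \<in> N})" and "\<mu> \<equiv> \<lambda>b. real (card {a. (a,b) \<in> N})"
  assumes fin: "finite Q" "finite P" and sub: "N \<subseteq> Q \<times> P" "M \<subseteq> Q \<times> P"
    and w: "0 < w" and \<theta>: "0 \<le> \<theta>" "\<theta> \<le> 1"
    and \<nu>w: "\<And>a. a \<in> Q \<Longrightarrow> \<nu> a \<le> w" and \<mu>w: "\<And>b. b \<in> P \<Longrightarrow> \<mu> b \<le> w"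
    and um: "\<And>a. a \<in> Q \<Longrightarrow> u a \<le> \<nu> a + card {b. (a,b) \<in> M}"
    and vm: "\<And>b. b \<in> P \<Longrightarrow> v b \<le> \<mu> b + card {a. (a,b) \<in> M}"
    and ur: "\<And>a. a \<in> Q \<Longrightarrow> u a \<le> \<nu> a + r" and vs: "\<And>b. b \<in> P \<Longrightarrow> v b \<le> \<mu> b + s"
    and uvr: "\<And>a b. (a,b) \<in> N \<Longrightarrow> u a + v b \<le> \<nu> a + r"
    and uvs: "\<And>a b. (a,b) \<in> N \<Longrightarrow> u a + v b \<le> \<mu> b + s"
  shows "(\<Sum>a\<in>Q. u a) + (\<Sum>b\<in>P. v b) - card N - card M
         \<le> (card Q * (2 * w * \<theta> + r)\<^sup>2 + card P * (2 * w * (1 - \<theta>) + s)\<^sup>2) / (8 * w)"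
proof -
  define f where "f a = max 0 (\<theta> - \<nu> a / w)" for a
  define g where "g b = max 0 ((1 - \<theta>) - \<mu> b / w)" for b
  have N1: "(\<Sum>a\<in>Q. \<nu> a) = card N" and N2: "(\<Sum>b\<in>P. \<mu> b) = card N"
    using sum_card_slices[OF fin sub(1)] unfolding \<nu>_def \<mu>_def by (metis of_nat_sum)+
  have M1: "(\<Sum>a\<in>Q. real (card {b. (a,b) \<in> M})) = card M"
    and M2: "(\<Sum>b\<in>P. real (card {a. (a,b) \<in> M})) = card M"
    using sum_card_slices[OF fin sub(2)] by (metis of_nat_sum)+
  have "(\<Sum>a\<in>Q. \<nu> a * u a) + (\<Sum>b\<in>P. \<mu> b * v b) = (\<Sum>(a,b)\<in>N. u a + v b)"
    using sum_over_slices(1)[OF fin sub(1), of u] sum_over_slices(2)[OF fin sub(1), of v] unfolding \<nu>_def \<mu>_def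
    by (simp add: case_prod_beta sum.distrib)
  also have "\<dots> \<le> (\<Sum>(a,b)\<in>N. (\<nu> a + r) / 2 + (\<mu> b + s) / 2)"
  proof (rule sum_mono, clarify)
    fix a b assume "(a,b) \<in> N"
    from uvr[OF this] uvs[OF this] show "u a + v b \<le> (\<nu> a + r) / 2 + (\<mu> b + s) / 2" by argo
  qed
  also have "\<dots> = (\<Sum>a\<in>Q. \<nu> a * ((\<nu> a + r) / 2)) + (\<Sum>b\<in>P. \<mu> b * ((\<mu> b + s) / 2))"
    using sum_over_slices(1)[OF fin sub(1), of "\<lambda>a. (\<nu> a + r) / 2"]
      sum_over_slices(2)[OF fin sub(1), of "\<lambda>b. (\<mu> b + s) / 2"]
    unfolding \<nu>_def \<mu>_def by (simp add: case_prod_beta sum.distrib)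
  finally have pairs: "(\<Sum>a\<in>Q. \<nu> a * u a) + (\<Sum>b\<in>P. \<mu> b * v b)
      \<le> (\<Sum>a\<in>Q. \<nu> a * ((\<nu> a + r) / 2)) + (\<Sum>b\<in>P. \<mu> b * ((\<mu> b + s) / 2))" .
  have U: "(\<Sum>a\<in>Q. u a) \<le> (\<Sum>a\<in>Q. \<nu> a * u a) / w + (\<Sum>a\<in>Q. (1 - \<nu> a / w) * \<nu> a)
      + (1 - \<theta>) * card M + (\<Sum>a\<in>Q. r * f a)"
  proof -
    have "(\<Sum>a\<in>Q. u a) \<le> (\<Sum>a\<in>Q. \<nu> a * u a / w + (1 - \<nu> a / w) * \<nu> a
        + (1 - \<theta>) * card {b. (a,b) \<in> M} + r * f a)"
      unfolding f_def by (intro sum_mono split_at_threshold) (use w \<theta> \<nu>w um ur in \<open>auto simp: \<nu>_def\<close>)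
    also have "\<dots> = (\<Sum>a\<in>Q. \<nu> a * u a) / w + (\<Sum>a\<in>Q. (1 - \<nu> a / w) * \<nu> a)
      + (1 - \<theta>) * card M + (\<Sum>a\<in>Q. r * f a)"
      by (simp only: sum.distrib M1[symmetric] sum_distrib_left sum_divide_distrib)
    finally show ?thesis .
  qed
  have V: "(\<Sum>b\<in>P. v b) \<le> (\<Sum>b\<in>P. \<mu> b * v b) / w + (\<Sum>b\<in>P. (1 - \<mu> b / w) * \<mu> b)
      + \<theta> * card M + (\<Sum>b\<in>P. s * g b)"
  proof -
    have "(\<Sum>b\<in>P. v b) \<le> (\<Sum>b\<in>P. \<mu> b * v b / w + (1 - \<mu> b / w) * \<mu> b
        + (1 - (1 - \<theta>)) * card {a. (a,b) \<in> M} + s * g b)"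
      unfolding g_def by (intro sum_mono split_at_threshold) (use w \<theta> \<mu>w vm vs in \<open>auto simp: \<mu>_def\<close>)
    also have "\<dots> = (\<Sum>b\<in>P. \<mu> b * v b) / w + (\<Sum>b\<in>P. (1 - \<mu> b / w) * \<mu> b)
      + (1 - (1 - \<theta>)) * card M + (\<Sum>b\<in>P. s * g b)"
      by (simp only: sum.distrib M2[symmetric] sum_distrib_left sum_divide_distrib)
    finally show ?thesis by simp
  qed
  have pairs': "(\<Sum>a\<in>Q. \<nu> a * u a) / w + (\<Sum>b\<in>P. \<mu> b * v b) / w
      \<le> (\<Sum>a\<in>Q. \<nu> a * ((\<nu> a + r) / 2) / w) + (\<Sum>b\<in>P. \<mu> b * ((\<mu> b + s) / 2) / w)"
    using divide_right_mono[OF pairs, of w] w by (simp add: add_divide_distrib sum_divide_distrib)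
  \<comment> \<open>Splitting \<open>card N\<close> in the ratio \<open>1 - \<theta>\<close> to \<open>\<theta>\<close> makes the linear terms fit \<open>peak_bound\<close>.\<close>
  have "real (card N) = (1 - \<theta>) * (\<Sum>a\<in>Q. \<nu> a) + \<theta> * (\<Sum>b\<in>P. \<mu> b)"
    unfolding N1 N2 by (simp add: algebra_simps)
  then have cN: "real (card N) = (\<Sum>a\<in>Q. (1 - \<theta>) * \<nu> a) + (\<Sum>b\<in>P. \<theta> * \<mu> b)"
    by (simp add: sum_distrib_left)
  have "(\<Sum>a\<in>Q. u a) + (\<Sum>b\<in>P. v b) - card N - card M
      \<le> (\<Sum>a\<in>Q. \<nu> a * ((\<nu> a + r) / 2) / w) + (\<Sum>a\<in>Q. (1 - \<nu> a / w) * \<nu> a)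
          + (\<Sum>a\<in>Q. r * f a) - (\<Sum>a\<in>Q. (1 - \<theta>) * \<nu> a)
        + ((\<Sum>b\<in>P. \<mu> b * ((\<mu> b + s) / 2) / w) + (\<Sum>b\<in>P. (1 - \<mu> b / w) * \<mu> b)
          + (\<Sum>b\<in>P. s * g b) - (\<Sum>b\<in>P. \<theta> * \<mu> b))"
    using U V pairs' cN by (simp add: algebra_simps)
  also have "\<dots> = (\<Sum>a\<in>Q. \<theta> * \<nu> a - (\<nu> a)\<^sup>2 / (2 * w) + r * \<nu> a / (2 * w) + r * f a)
      + (\<Sum>b\<in>P. (1 - \<theta>) * \<mu> b - (\<mu> b)\<^sup>2 / (2 * w) + s * \<mu> b / (2 * w) + s * g b)"
  proof -
    have "\<nu> a * ((\<nu> a + r) / 2) / w + (1 - \<nu> a / w) * \<nu> a + r * f a - (1 - \<theta>) * \<nu> a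
        = \<theta> * \<nu> a - (\<nu> a)\<^sup>2 / (2 * w) + r * \<nu> a / (2 * w) + r * f a" for a
      using w by (simp add: field_simps power2_eq_square)
    moreover have "\<mu> b * ((\<mu> b + s) / 2) / w + (1 - \<mu> b / w) * \<mu> b + s * g b - \<theta> * \<mu> b
        = (1 - \<theta>) * \<mu> b - (\<mu> b)\<^sup>2 / (2 * w) + s * \<mu> b / (2 * w) + s * g b" for b
      using w by (simp add: field_simps power2_eq_square)
    ultimately show ?thesis by (simp only: sum.distrib[symmetric] sum_subtractf[symmetric])
  qed
  also have "\<dots> \<le> (\<Sum>a\<in>Q. (2 * w * \<theta> + r)\<^sup>2 / (8 * w)) + (\<Sum>b\<in>P. (2 * w * (1 - \<theta>) + s)\<^sup>2 / (8 * w))"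
    unfolding f_def g_def by (intro add_mono sum_mono peak_bound w)
  finally show ?thesis by (simp add: add_divide_distrib)
qed

section \<open>The choice of the threshold\<close>

text \<open>
  With \<open>t = 1 - r\<close> this says that the quadratic in \<open>x\<close> of the next lemma has negative discriminant.
\<close>

lemma discriminant_negative:
  fixes r w c :: real
  assumes w: "w = 747/1987" and c: "c = 620/1987" and r: "0 \<le> r"
  shows "(1 - r) * (8 * w + (2 * w + r)\<^sup>2)\<^sup>2 < 32 * w * c * (8 * w * (1 - r) + (2 * w + r)\<^sup>2)"
proof -
  define A where "A = 8 * w + 4 * w\<^sup>2"
  define D where "D = 32 * w * c"
  have "D * (8 * w * (1 - r) + (2 * w + r)\<^sup>2) - (1 - r) * (8 * w + (2 * w + r)\<^sup>2)\<^sup>2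
     = (D * A - A\<^sup>2) + (A\<^sup>2 - 8 * w * A - 4 * w * D) * r + (D + 8 * w * A - 2 * A - 16 * w\<^sup>2) * r^2
        + (2 * A + 16 * w\<^sup>2 - 8 * w) * r^3 + (8 * w - 1) * r^4 + r^5"
    unfolding A_def by (simp add: algebra_simps power2_eq_square eval_nat_numeral)
  moreover have coeffs: "D * A - A\<^sup>2 \<ge> 64/100" "A\<^sup>2 - 8 * w * A - 4 * w * D \<ge> - (363/100)"
      "D + 8 * w * A - 2 * A - 16 * w\<^sup>2 \<ge> 5" "2 * A + 16 * w\<^sup>2 - 8 * w \<ge> 6" "8 * w - 1 \<ge> 0"
    unfolding A_def D_def w c by (simp_all add: power2_eq_square)
  have "(A\<^sup>2 - 8 * w * A - 4 * w * D) * r \<ge> - (363/100) * r"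
      "(D + 8 * w * A - 2 * A - 16 * w\<^sup>2) * r^2 \<ge> 5 * r^2"
      "(2 * A + 16 * w\<^sup>2 - 8 * w) * r^3 \<ge> 6 * r^3" "(8 * w - 1) * r^4 \<ge> 0"
    using mult_right_mono[OF coeffs(2) r] mult_right_mono[OF coeffs(3), of "r^2"]
      mult_right_mono[OF coeffs(4), of "r^3"] mult_nonneg_nonneg[OF coeffs(5), of "r^4"] r by simp_all
  \<comment> \<open>The tangent of \<open>r\<^sup>3\<close> at \<open>r = 1/4\<close>, near which the polynomial is smallest.\<close>
  moreover have "r^3 \<ge> 3/16 * r - 1/32"
  proof -
    have "r^3 - 3/16 * r + 1/32 = (r - 1/4)\<^sup>2 * (r + 1/2)"
      by (simp add: field_simps power2_eq_square eval_nat_numeral)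
    moreover have "\<dots> \<ge> 0" using r by simp
    ultimately show ?thesis by linarith
  qed
  moreover have "5 * r^2 - (363/100 - 18/16) * r + (64/100 - 6/32) > 0"
  proof -
    have "5 * r^2 - (363/100 - 18/16) * r + (64/100 - 6/32)
        = 5 * (r - 501/2000)\<^sup>2 + (64/100 - 6/32 - 5 * (501/2000)\<^sup>2)"
      by (simp add: field_simps power2_eq_square)
    moreover have "64/100 - 6/32 - 5 * (501/2000)\<^sup>2 > (0::real)" by (simp add: power2_eq_square)
    ultimately show ?thesis using zero_le_power2[of "r - 501/2000"] by linarith
  qed
  moreover have "r^5 \<ge> 0" using r by simp
  ultimately have "D * (8 * w * (1 - r) + (2 * w + r)\<^sup>2) - (1 - r) * (8 * w + (2 * w + r)\<^sup>2)\<^sup>2 > 0"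
    using coeffs(1) by argo
  then show ?thesis unfolding D_def by simp
qed

text \<open>
  The total bound at the equalising threshold below, with \<open>x = \<alpha>\<close>, \<open>t = \<alpha> + q\<close> and \<open>r + s = 1 - t\<close>.
\<close>

lemma balanced_bound:
  fixes x t w c :: real
  assumes w: "w = 747/1987" and c: "c = 620/1987" and t: "0 < t" "t \<le> 1"
  shows "x * (1 - x) + x * (t - x) * (2 * w + (1 - t))\<^sup>2 / (8 * w * t) \<le> c"
proof -
  define K where "K = (2 * w + (1 - t))\<^sup>2"
  define a where "a = 8 * w * t + K"
  define b where "b = t * (8 * w + K)"
  define d where "d = 8 * w * t * c"
  have w0: "w > 0" using w by simp
  have K0: "K \<ge> 0" by (simp add: K_def)
  have a0: "a > 0" using w0 t K0 by (simp add: a_def add_pos_nonneg)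
  have "t * (8 * w + K)\<^sup>2 < 32 * w * c * (8 * w * t + K)"
    using discriminant_negative[OF w c, of "1 - t"] t by (simp add: K_def)
  then have "t * (t * (8 * w + K)\<^sup>2) < t * (32 * w * c * (8 * w * t + K))"
    using t by simp
  then have "b\<^sup>2 < 4 * a * d"
    by (simp add: a_def b_def d_def power2_eq_square algebra_simps)
  moreover have "4 * a * (a * x\<^sup>2 - b * x + d) = (2 * a * x - b)\<^sup>2 + (4 * a * d - b\<^sup>2)"
    by (simp add: power2_eq_square algebra_simps)
  ultimately have "4 * a * (a * x\<^sup>2 - b * x + d) > 0"
    using zero_le_power2[of "2 * a * x - b"] by linarith
  then have "a * x\<^sup>2 - b * x + d > 0" using a0 by (simp add: zero_less_mult_iff)
  then have "x * (t - x) * K \<le> (c - x * (1 - x)) * (8 * w * t)"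
    by (simp add: a_def b_def d_def power2_eq_square algebra_simps)
  then have "x * (t - x) * K / (8 * w * t) \<le> c - x * (1 - x)"
    using w0 t by (simp add: pos_divide_le_eq)
  then show ?thesis by (simp add: K_def)
qed

text \<open>
  An upper estimate of the total bound at \<open>\<theta> = 1\<close>, for the largest \<open>q\<close> that makes this choice necessary, with \<open>x = \<alpha>\<close>
  and the denominator cleared.
\<close>

lemma unbalanced_bound:
  fixes x w c :: real
  assumes w: "w = 747/1987" and c: "c = 620/1987" and x: "0 \<le> x"
  shows "x * (1 - x) * (11/4 * w + x) \<le> c * (2 * w + x)"
proof -
  \<comment> \<open>The tangent of \<open>x\<^sup>3\<close> at \<open>48/100\<close>, near the minimum of the cubic on the positive axis.\<close>
  have "x^3 - (3 * (48/100)\<^sup>2 * x - 2 * (48/100)^3) = (x - 48/100)\<^sup>2 * (x + 96/100)"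
    by (simp add: field_simps power2_eq_square eval_nat_numeral)
  moreover have "\<dots> \<ge> 0" using x by simp
  ultimately have 1: "x^3 \<ge> 6912/10000 * x - 221184/1000000" by (simp add: power2_eq_square eval_nat_numeral)
  have 2: "(11/4 * w - 1) * x\<^sup>2 \<ge> 33/1000 * x\<^sup>2" unfolding w by (intro mult_right_mono) auto
  have 3: "(c - 11/4 * w) * x \<ge> - (722/1000) * x" unfolding w c using x by (intro mult_right_mono) auto
  have 4: "2 * w * c \<ge> 2346/10000" unfolding w c by simp
  have "33/1000 * x\<^sup>2 - 308/10000 * x + 13416/1000000
     = 33/1000 * (x - 154/330)\<^sup>2 + (13416/1000000 - 33/1000 * (154/330)\<^sup>2)"
    by (simp add: field_simps power2_eq_square)
  moreover have "13416/1000000 - 33/1000 * (154/330)\<^sup>2 > (0::real)" by (simp add: power2_eq_square)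
  ultimately have 5: "33/1000 * x\<^sup>2 - 308/10000 * x + 13416/1000000 \<ge> 0"
    using zero_le_power2[of "x - 154/330"] by linarith
  have "c * (2 * w + x) - x * (1 - x) * (11/4 * w + x)
      = x^3 + (11/4 * w - 1) * x\<^sup>2 + (c - 11/4 * w) * x + 2 * w * c"
    by (simp add: field_simps power2_eq_square eval_nat_numeral)
  then show ?thesis using 1 2 3 4 5 by linarith
qed

text \<open>
  All quantities are divided by \<open>S\<close>; \<open>\<alpha>\<close> and \<open>q\<close> are the \<open>H\<close>-degrees of \<open>a0\<close> and \<open>b0\<close>, and \<open>r\<close>, \<open>s\<close>
  bound how far the degrees in \<open>G\<close> of the \<open>H\<close>-neighbours of \<open>b0\<close> and \<open>a0\<close> can exceed \<open>\<alpha>\<close> and \<open>q\<close>.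
  The two squares, weighted by \<open>q\<close> and \<open>\<alpha>\<close>, have arguments of constant sum, so their sum is least
  for the \<open>\<theta>\<close> that equalises \<open>q (2w\<theta> + r)\<close> and \<open>\<alpha> (2w(1 - \<theta>) + s)\<close>. When that \<open>\<theta>\<close> exceeds one,
  which needs \<open>q\<close> small, \<open>\<theta> = 1\<close> is used instead. In both cases the bound is largest when
  \<open>r + s = 1 - \<alpha> - q\<close>, that is, when the Ore condition is tight at \<open>a0 b0\<close>.
\<close>

lemma optimal_threshold:
  fixes \<alpha> q r s w c :: real
  assumes wv: "w = 747/1987" and cv: "c = 620/1987"
    and q: "0 \<le> q" "q \<le> \<alpha>" and rs: "0 \<le> r" "0 \<le> s"
    and r1: "\<alpha> + q + r \<le> 1" and s1: "\<alpha> + q + s \<le> 1" and rs1: "1 \<le> \<alpha> + q + r + s"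
    and big: "1 - w \<le> \<alpha> + q"
  obtains \<theta> where "0 \<le> \<theta>" "\<theta> \<le> 1"
    "\<alpha> * (2 - 2 * \<alpha> - q - r - s)
      + (q * (2 * w * \<theta> + r)\<^sup>2 + \<alpha> * (2 * w * (1 - \<theta>) + s)\<^sup>2) / (8 * w) \<le> c"
proof -
  define t where "t = \<alpha> + q"
  define \<rho> where "\<rho> = r + s"
  have w: "0 < w" "w < 1/2" using wv by auto
  have t: "0 < t" "t \<le> 1" using big w r1 rs by (auto simp: t_def)
  have \<alpha>: "0 < \<alpha>" "\<alpha> \<le> 1" using t q by (auto simp: t_def)
  have rw: "r \<le> w" "s \<le> w" using big r1 s1 by auto
  have \<rho>: "1 - t \<le> \<rho>" "\<rho> \<le> 2 * w" "1 - t \<le> w" using rw rs1 big by (auto simp: t_def \<rho>_def)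
  show ?thesis
  proof (cases "\<alpha> * s \<le> q * (2 * w + r)")
    case True
    define \<theta> where "\<theta> = (\<alpha> * (2 * w + s) - q * r) / (2 * w * t)"
    have "q * r \<le> \<alpha> * (2 * w + s)" using q rs rw w \<alpha> by (intro mult_mono) auto
    then have "0 \<le> \<theta>" using w t by (simp add: \<theta>_def)
    have "\<alpha> * (2 * w + s) - q * r \<le> 2 * w * t" using True by (simp add: t_def algebra_simps)
    then have "\<theta> \<le> 1" using w t by (simp add: \<theta>_def)
    define X where "X = 2 * w + \<rho>"
    have th: "2 * w * \<theta> = (\<alpha> * (2 * w + s) - q * r) / t" using w t by (simp add: \<theta>_def)
    have e1: "2 * w * \<theta> + r = \<alpha> * X / t"
      unfolding th using t by (simp add: X_def \<rho>_def t_def field_simps)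
    have "2 * w * (1 - \<theta>) + s = 2 * w + s - 2 * w * \<theta>" by (simp add: algebra_simps)
    then have e2: "2 * w * (1 - \<theta>) + s = q * X / t"
      unfolding th using t by (simp add: X_def \<rho>_def t_def field_simps)
    have "q * (\<alpha> * X / t)\<^sup>2 + \<alpha> * (q * X / t)\<^sup>2 = \<alpha> * q * X\<^sup>2 * (\<alpha> + q) / t\<^sup>2"
      by (simp add: power2_eq_square add_divide_distrib algebra_simps)
    also have "\<dots> = \<alpha> * q * X\<^sup>2 / t" using t by (simp add: t_def[symmetric] power2_eq_square)
    finally have e3: "q * (2 * w * \<theta> + r)\<^sup>2 + \<alpha> * (2 * w * (1 - \<theta>) + s)\<^sup>2 = \<alpha> * q * X\<^sup>2 / t"
      unfolding e1 e2 .
    \<comment> \<open>\<open>Y\<close> is the value of \<open>X\<close> at the least possible \<open>\<rho>\<close>.\<close>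
    define Y where "Y = 2 * w + (1 - t)"
    have "X\<^sup>2 - Y\<^sup>2 = (\<rho> - (1 - t)) * (X + Y)" by (simp add: X_def Y_def power2_eq_square algebra_simps)
    also have "\<dots> \<le> (\<rho> - (1 - t)) * (8 * w)"
      using \<rho> w by (intro mult_left_mono) (auto simp: X_def Y_def)
    finally have "X\<^sup>2 \<le> Y\<^sup>2 + (\<rho> - (1 - t)) * (8 * w)" by simp
    then have "\<alpha> * q * X\<^sup>2 \<le> \<alpha> * q * (Y\<^sup>2 + (\<rho> - (1 - t)) * (8 * w))"
      using \<alpha> q by (intro mult_left_mono) auto
    then have "\<alpha> * q * X\<^sup>2 / (8 * w * t) \<le> \<alpha> * q * (Y\<^sup>2 + (\<rho> - (1 - t)) * (8 * w)) / (8 * w * t)"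
      using w t by (intro divide_right_mono) auto
    also have "\<dots> = \<alpha> * q * Y\<^sup>2 / (8 * w * t) + \<alpha> * (\<rho> - (1 - t)) * (q / t)"
      using w t by (simp add: field_simps)
    also have "\<alpha> * (\<rho> - (1 - t)) * (q / t) \<le> \<alpha> * (\<rho> - (1 - t)) * 1"
      using \<alpha> \<rho> q t by (intro mult_left_mono) (auto simp: t_def)
    finally have "\<alpha> * q * X\<^sup>2 / (8 * w * t) \<le> \<alpha> * q * Y\<^sup>2 / (8 * w * t) + \<alpha> * (\<rho> - (1 - t))" by simp
    moreover have "\<alpha> * (1 - \<alpha>) + \<alpha> * q * Y\<^sup>2 / (8 * w * t) \<le> c"
      using balanced_bound[OF wv cv t, of \<alpha>] by (simp add: Y_def t_def)
    moreover have "\<alpha> * (2 - 2 * \<alpha> - q - r - s) = \<alpha> * (1 - \<alpha>) - \<alpha> * (\<rho> - (1 - t))"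
      by (simp add: \<rho>_def t_def algebra_simps)
    moreover have "\<alpha> * q * X\<^sup>2 / t / (8 * w) = \<alpha> * q * X\<^sup>2 / (8 * w * t)" by (simp add: mult.commute)
    ultimately show ?thesis using that[OF \<open>0 \<le> \<theta>\<close> \<open>\<theta> \<le> 1\<close>] unfolding e3 by linarith
  next
    case False
    then have F: "q * (2 * w + r) < \<alpha> * s" by simp
    define p where "p = 1 - t"
    have p: "0 \<le> p" "p \<le> w" "p \<le> \<rho>" "s \<le> p" using t \<rho> s1 by (auto simp: p_def t_def)
    \<comment> \<open>Reduction to \<open>r = 0\<close>: here shifting weight from \<open>r\<close> to \<open>s\<close> increases the expression.\<close>
    have "q * r * (4 * w + r) \<le> 2 * r * (q * (2 * w + r))"
      using q rs w by (simp add: algebra_simps)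
    also have "\<dots> \<le> 2 * r * (\<alpha> * s)" using F rs by (intro mult_left_mono) auto
    finally have "q * (2 * w + r)\<^sup>2 + \<alpha> * s\<^sup>2 \<le> 4 * w\<^sup>2 * q + \<alpha> * (2 * r * s + s\<^sup>2)"
      by (simp add: power2_eq_square algebra_simps)
    also have "\<dots> \<le> 4 * w\<^sup>2 * q + \<alpha> * \<rho>\<^sup>2"
      using \<alpha> by (intro add_left_mono mult_left_mono) (auto simp: \<rho>_def power2_eq_square algebra_simps)
    also have "\<rho>\<^sup>2 \<le> w * p + (\<rho> - p) * (8 * w)"
    proof -
      have "\<rho>\<^sup>2 - p\<^sup>2 = (\<rho> - p) * (\<rho> + p)" by (simp add: power2_eq_square algebra_simps)
      also have "\<dots> \<le> (\<rho> - p) * (8 * w)" using p \<rho> w by (intro mult_left_mono) auto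
      moreover have "p\<^sup>2 \<le> w * p" using p by (simp add: power2_eq_square mult_right_mono)
      ultimately show ?thesis by linarith
    qed
    finally have "q * (2 * w + r)\<^sup>2 + \<alpha> * s\<^sup>2 \<le> 4 * w\<^sup>2 * q + \<alpha> * (w * p + (\<rho> - p) * (8 * w))"
      using \<alpha> by simp
    then have "(q * (2 * w + r)\<^sup>2 + \<alpha> * s\<^sup>2) / (8 * w)
        \<le> (4 * w\<^sup>2 * q + \<alpha> * (w * p + (\<rho> - p) * (8 * w))) / (8 * w)"
      using w by (intro divide_right_mono) auto
    also have "\<dots> = w * q / 2 + \<alpha> * p / 8 + \<alpha> * (\<rho> - p)"
      using w by (simp add: field_simps power2_eq_square)
    finally have 1: "(q * (2 * w + r)\<^sup>2 + \<alpha> * s\<^sup>2) / (8 * w) \<le> w * q / 2 + \<alpha> * p / 8 + \<alpha> * (\<rho> - p)" .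
    have "2 * w * q \<le> q * (2 * w + r)" using q rs by (simp add: algebra_simps)
    also have "\<dots> \<le> \<alpha> * p" using F p \<alpha> by (smt (verit) mult_left_mono)
    finally have "q * (2 * w + \<alpha>) \<le> \<alpha> * (1 - \<alpha>)" by (simp add: p_def t_def algebra_simps)
    \<comment> \<open>The expression increases with \<open>q\<close>, so the largest admissible \<open>q\<close> decides.\<close>
    moreover have "0 \<le> 4 * w - \<alpha>" using \<alpha> wv by simp
    ultimately have "(4 * w - \<alpha>) * (q * (2 * w + \<alpha>)) \<le> (4 * w - \<alpha>) * (\<alpha> * (1 - \<alpha>))"
      by (rule mult_left_mono)
    moreover have "\<alpha> * (1 - \<alpha>) * (11/4 * w + \<alpha>) \<le> c * (2 * w + \<alpha>)"
      by (rule unbalanced_bound[OF wv cv]) (use \<alpha> in simp)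
    moreover have "(2 * w + \<alpha>) * (\<alpha> * (1 - \<alpha>) + w * q / 2 + \<alpha> * p / 8)
        = \<alpha> * (1 - \<alpha>) * (2 * w + \<alpha>) * (9/8) + (4 * w - \<alpha>) * (q * (2 * w + \<alpha>)) / 8"
      by (simp add: p_def t_def field_simps)
    moreover have "\<alpha> * (1 - \<alpha>) * (2 * w + \<alpha>) * (9/8) + (4 * w - \<alpha>) * (\<alpha> * (1 - \<alpha>)) / 8
        = \<alpha> * (1 - \<alpha>) * (11/4 * w + \<alpha>)"
      by (simp add: field_simps)
    ultimately have "(2 * w + \<alpha>) * (\<alpha> * (1 - \<alpha>) + w * q / 2 + \<alpha> * p / 8) \<le> (2 * w + \<alpha>) * c"
      by (simp add: mult.commute)
    then have "\<alpha> * (1 - \<alpha>) + w * q / 2 + \<alpha> * p / 8 \<le> c"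
      using w \<alpha> by (simp add: mult_le_cancel_left_pos)
    moreover have "\<alpha> * (2 - 2 * \<alpha> - q - r - s) = \<alpha> * (1 - \<alpha>) - \<alpha> * (\<rho> - p)"
      by (simp add: \<rho>_def p_def t_def algebra_simps)
    ultimately show ?thesis using that[of 1] 1 by simp
  qed
qed

section \<open>Neighbourhoods in a bipartite strong clique\<close>

lemma finite_ex_argmax:
  fixes f :: "'a \<Rightarrow> nat"
  assumes "finite A" "A \<noteq> {}"
  obtains a where "a \<in> A" "\<And>x. x \<in> A \<Longrightarrow> f x \<le> f a"
proof -
  have "Max (f ` A) \<in> f ` A" using assms by (intro Max_in) auto
  then obtain a where "a \<in> A" "f a = Max (f ` A)" by auto
  then show ?thesis using that[of a] assms(1) by simp
qed

text \<open>
  Used for an \<open>H\<close>-edge from \<open>x\<close> to \<open>y\<close>. The edges at \<open>G\<close>-neighbours of \<open>y\<close> on the far side are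
  counted by other means, so these neighbours are removed from the neighbourhood of \<open>x\<close>.
\<close>

definition private_nbrs :: "('v \<Rightarrow> 'v \<Rightarrow> bool) \<Rightarrow> ('v \<times> 'v) set \<Rightarrow> 'v \<Rightarrow> 'v \<Rightarrow> 'v set" where
  "private_nbrs E H x y = {z \<in> H `` {x}. \<not> E y z}"

text \<open>
  The number of \<open>H\<close>-edges from \<open>a\<close> that avoid the \<open>G\<close>-neighbours of \<open>x\<close>, reduced by the non-edges from
  \<open>a\<close> to the removed neighbours of \<open>x\<close>. The correction, which may make the value
  negative, keeps the comparison with the degree of \<open>x\<close> valid after the removal.
\<close>

definition excess :: "('v \<Rightarrow> 'v \<Rightarrow> bool) \<Rightarrow> ('v \<times> 'v) set \<Rightarrow> 'v \<Rightarrow> 'v \<Rightarrow> 'v \<Rightarrow> real" where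
  "excess E H x y a = real (card {z \<in> H `` {a}. \<not> E x z}) - real (card {z \<in> H `` {x}. E y z \<and> (a,z) \<notin> H})"

text \<open>
  \<open>H\<close> is a set of edges of the graph \<open>(V,E)\<close>, directed from one side to the other. The condition
  \<open>joined\<close> is only a restriction for disjoint edges, since for edges with a common end it follows
  from \<open>H_E\<close>. Stated for all pairs it is inherited by blow-ups.
\<close>

locale strong_pairs =
  fixes V :: "'v set" and E :: "'v \<Rightarrow> 'v \<Rightarrow> bool" and H :: "('v \<times> 'v) set"
  assumes finite_V: "finite V"
    and E_sym: "E x y \<Longrightarrow> E y x"
    and H_V: "H \<subseteq> V \<times> V"
    and H_E: "(a,b) \<in> H \<Longrightarrow> E a b"
    and sides_disjoint: "Domain H \<inter> Range H = {}"
    and joined: "(a,b) \<in> H \<Longrightarrow> (a',b') \<in> H \<Longrightarrow> E a a' \<or> E b b' \<or> E a b' \<or> E a' b"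
begin

definition deg :: "'v \<Rightarrow> nat" where "deg x = card {y \<in> V. E x y}"

lemma swap: "strong_pairs V E (H\<inverse>)"
proof
  show "Domain (H\<inverse>) \<inter> Range (H\<inverse>) = {}" using sides_disjoint by auto
  show "E a a' \<or> E b b' \<or> E a b' \<or> E a' b" if "(a,b) \<in> H\<inverse>" "(a',b') \<in> H\<inverse>" for a b a' b'
    using joined[of b a b' a'] that E_sym by blast
qed (use finite_V E_sym H_V H_E in auto)

lemma finite_H: "finite H" using finite_V H_V by (meson finite_SigmaI finite_subset)

lemma finite_nbrs [simp]: "finite (H `` A)" "finite (H\<inverse> `` A)" "finite (Domain H)" "finite (Range H)"
  using finite_H by (auto simp: finite_Domain finite_Range)

lemma finite_filtered_nbrs [simp]: "finite {z. (x,z) \<in> H \<and> R z}" "finite {z. (z,x) \<in> H \<and> R z}"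
  using finite_subset[OF _ finite_nbrs(1)[of "{x}"], of "{z. (x,z) \<in> H \<and> R z}"]
    finite_subset[OF _ finite_nbrs(2)[of "{x}"], of "{z. (z,x) \<in> H \<and> R z}"] by auto

lemma deg_ge: "A \<subseteq> V \<Longrightarrow> (\<And>y. y \<in> A \<Longrightarrow> E x y) \<Longrightarrow> card A \<le> deg x"
  unfolding deg_def by (rule card_mono) (use finite_V in auto)

lemma deg_ge_two_sides:
  assumes "A \<subseteq> Domain H" "B \<subseteq> Range H" "\<And>y. y \<in> A \<union> B \<Longrightarrow> E x y"
  shows "card A + card B \<le> deg x"
proof -
  have "finite A" "finite B" using assms(1,2) finite_nbrs(3,4) by (meson finite_subset)+
  then have "card A + card B = card (A \<union> B)"
    by (subst card_Un_disjoint) (use assms sides_disjoint in auto)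
  also have "\<dots> \<le> deg x" by (rule deg_ge) (use assms H_V in blast)+
  finally show ?thesis .
qed

text \<open>
  The constraints on one \<open>H\<close>-neighbour \<open>a\<close> of \<open>b0\<close>; those on the other side follow by reversing \<open>H\<close>.
  Here \<open>\<nu>\<close> counts the pairs in \<open>N\<close> and \<open>m\<close> those in \<open>M\<close> at \<open>a\<close>, and \<open>g\<close> is the degree of \<open>a\<close> into its own
  side. The first fact is the maximality of \<open>a0\<close>, the second the Ore condition at \<open>a b0\<close>. For
  the fourth, \<open>a b0\<close> must be joined to each edge that leaves at \<open>b\<close>, and three of the four ways to do
  so are excluded.

  For the third, an edge from \<open>a\<close> to some \<open>b'\<close> not adjacent to \<open>a0\<close> has \<open>b'\<close> adjacent to all \<open>\<nu>\<close> points,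
  by the same argument with \<open>a0\<close>. So \<open>d(b') \<ge> \<nu> + h(b')\<close>, and heaviness of \<open>a b'\<close> leaves
  room for \<open>S - L\<close> points only. If there is no such edge, then \<open>h(a) \<le> d(a0) - \<nu>\<close>, and heaviness of
  \<open>a b0\<close> gives the same bound.
\<close>

lemma side_facts:
  fixes S L :: real
  assumes e0: "(a0,b0) \<in> H" and ab0: "(a,b0) \<in> H" and far: "\<not> E a0 a"
    and max: "card (H `` {a}) \<le> card (H `` {a0})"
    and S: "\<And>x y. (x,y) \<in> H \<Longrightarrow> real (deg x + deg y) \<le> S"
    and L: "\<And>x y. (x,y) \<in> H \<Longrightarrow> L \<le> real (card (H `` {x}) + card (H\<inverse> `` {y}))"
  defines "P \<equiv> private_nbrs E H a0 b0"
  defines "\<nu> \<equiv> card {b \<in> P. \<not> E a b}"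
    and "m \<equiv> card {b \<in> P. E a b \<and> (a,b) \<notin> H}"
    and "g \<equiv> card {c \<in> Domain H. E a c}"
  shows "excess E H a0 b0 a \<le> real \<nu> + real m"
    and "real g + excess E H a0 b0 a \<le> real \<nu> + (S - deg b0 - card (H `` {a0}))"
    and "real \<nu> \<le> S - L"
    and "\<And>b. b \<in> P \<Longrightarrow> \<not> E a b \<Longrightarrow> card {c \<in> H\<inverse> `` {b}. \<not> E b0 c} \<le> g"
proof -
  define N where "N = {b \<in> P. \<not> E a b}"
  define M where "M = {b \<in> P. E a b \<and> (a,b) \<notin> H}"
  define W where "W = {z \<in> H `` {a0}. E b0 z \<and> (a,z) \<notin> H}"
  define U where "U = {z \<in> H `` {a}. \<not> E a0 z}"
  define C where "C = H `` {a0} \<inter> H `` {a}"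
  have fin: "finite N" "finite M" "finite W" "finite U" "finite C"
    unfolding N_def M_def W_def U_def C_def P_def private_nbrs_def by simp_all
  have ex: "excess E H a0 b0 a = real (card U) - real (card W)" by (simp add: excess_def U_def W_def)
  have "H `` {a0} = C \<union> N \<union> M \<union> W"
    unfolding N_def M_def W_def C_def P_def private_nbrs_def using H_E by blast
  moreover have "card (C \<union> N \<union> M \<union> W) = card C + card N + card M + card W"
  proof -
    have "C \<inter> N = {}" "(C \<union> N) \<inter> M = {}" "(C \<union> N \<union> M) \<inter> W = {}"
      using H_E by (auto simp: N_def M_def W_def C_def P_def private_nbrs_def)
    then show ?thesis using fin by (simp add: card_Un_disjoint)
  qed
  ultimately have \<alpha>: "card (H `` {a0}) = card C + card N + card M + card W" by simp
  have CU: "card C + card U = card (C \<union> U)"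
    using fin H_E by (subst card_Un_disjoint) (auto simp: C_def U_def)
  also have "\<dots> \<le> card (H `` {a})" by (rule card_mono) (auto simp: C_def U_def)
  finally have hU: "card C + card U \<le> card (H `` {a})" .
  show 1: "excess E H a0 b0 a \<le> real \<nu> + real m"
    using hU max \<alpha> unfolding ex \<nu>_def m_def N_def[symmetric] M_def[symmetric] by linarith
  have "card {c \<in> Domain H. E a c} + card (C \<union> U \<union> M) \<le> deg a"
    by (rule deg_ge_two_sides) (use H_E in \<open>auto simp: C_def U_def M_def P_def private_nbrs_def\<close>)
  moreover have "card (C \<union> U \<union> M) = card C + card U + card M"
    unfolding CU using fin by (subst card_Un_disjoint) (auto simp: C_def U_def M_def)
  ultimately show "real g + excess E H a0 b0 a \<le> real \<nu> + (S - deg b0 - card (H `` {a0}))"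
    using S[OF ab0] \<alpha> unfolding ex \<nu>_def g_def N_def[symmetric] by linarith
  \<comment> \<open>The edges \<open>a0 b\<close> and \<open>a b'\<close> can only be joined by \<open>b b'\<close>.\<close>
  have far_N: "E b' b" if "b' \<in> U" "b \<in> N" for b b'
    using joined[of a0 b a b'] that far E_sym unfolding U_def N_def P_def private_nbrs_def by blast
  show "real \<nu> \<le> S - L"
  proof (cases "U = {}")
    case False
    then obtain b' where b': "b' \<in> U" by blast
    then have ab': "(a,b') \<in> H" by (simp add: U_def)
    have "card (H\<inverse> `` {b'}) + card N \<le> deg b'"
      by (rule deg_ge_two_sides) (use far_N[OF b'] H_E E_sym in \<open>auto simp: N_def P_def private_nbrs_def\<close>)
    moreover have "card (H `` {a}) \<le> deg a" by (rule deg_ge) (use H_E H_V in auto)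
    ultimately show ?thesis using S[OF ab'] L[OF ab'] unfolding \<nu>_def N_def[symmetric] by linarith
  next
    case True
    define D where "D = H `` {a} - H `` {a0}"
    have finD: "finite D" by (simp add: D_def)
    have "card (H `` {a}) = card C + card D"
      unfolding C_def D_def by (metis Int_commute card_Int_Diff finite_nbrs(1))
    moreover have "card (H `` {a0}) + card D = card (H `` {a0} \<union> D)"
      using finD by (subst card_Un_disjoint) (auto simp: D_def)
    moreover have "card (H `` {a0} \<union> D) \<le> deg a0"
      by (rule deg_ge) (use True H_E H_V in \<open>auto simp: U_def D_def\<close>)
    moreover have "card (H\<inverse> `` {b0}) \<le> deg b0" by (rule deg_ge) (use H_E H_V E_sym in auto)
    ultimately show ?thesis using S[OF e0] L[OF ab0] \<alpha> unfolding \<nu>_def N_def[symmetric] by linarith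
  qed
  show "card {c \<in> H\<inverse> `` {b}. \<not> E b0 c} \<le> g" if b: "b \<in> P" "\<not> E a b" for b
    unfolding g_def
  proof (rule card_mono)
    show "{c \<in> H\<inverse> `` {b}. \<not> E b0 c} \<subseteq> {c \<in> Domain H. E a c}"
      using joined[OF ab0] b E_sym unfolding P_def private_nbrs_def by blast
  qed simp
qed

text \<open>
  Every edge is joined to \<open>a0 b0\<close>. Either it has an end in \<open>RA\<close> or \<open>RB\<close>, the \<open>G\<close>-neighbours of
  \<open>a0\<close> and \<open>b0\<close> that are not their \<open>H\<close>-neighbours, or it has an end in \<open>Q\<close> or in \<open>P\<close>. Edges of the
  first kind are estimated by \<open>\<alpha>\<close> for each end; those of the second kind are
  the edges inside the rectangle \<open>Q \<times> P\<close> and those that leave it from \<open>Q\<close> or from \<open>P\<close>. The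
  corrections in \<open>excess\<close> are paid for by the gap between \<open>|Q| |P|\<close> and \<open>q \<alpha>\<close>.
\<close>

lemma card_H_le_excess:
  fixes \<alpha> :: real
  assumes e0: "(a0,b0) \<in> H"
    and max: "\<And>x. real (card (H `` {x})) \<le> \<alpha>" "\<And>y. real (card (H\<inverse> `` {y})) \<le> \<alpha>"
    and \<alpha>: "real (card (H `` {a0})) = \<alpha>"
  defines "q \<equiv> real (card (H\<inverse> `` {b0}))"
    and "Q \<equiv> private_nbrs E (H\<inverse>) b0 a0" and "P \<equiv> private_nbrs E H a0 b0"
  shows "real (card H) \<le> \<alpha> * (deg a0 + deg b0 - \<alpha>)
     + ((\<Sum>a\<in>Q. excess E H a0 b0 a) + (\<Sum>b\<in>P. excess E (H\<inverse>) b0 a0 b)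
     - card {(a,b) \<in> Q \<times> P. \<not> E a b} - card {(a,b) \<in> Q \<times> P. E a b \<and> (a,b) \<notin> H})"
proof -
  define RA where "RA = {x \<in> Domain H. E a0 x} \<union> ({x \<in> Domain H. E b0 x} - H\<inverse> `` {b0})"
  define RB where "RB = {y \<in> Range H. E b0 y} \<union> ({y \<in> Range H. E a0 y} - H `` {a0})"
  define u where "u a = card {z \<in> H `` {a}. \<not> E a0 z}" for a
  define v where "v b = card {z \<in> H\<inverse> `` {b}. \<not> E b0 z}" for b
  have fin: "finite Q" "finite P"
    unfolding Q_def P_def private_nbrs_def by simp_all
  have "H \<subseteq> (SIGMA a:RA. H `` {a}) \<union> prod.swap ` (SIGMA b:RB. H\<inverse> `` {b}) \<union> (H \<inter> Q \<times> P)
      \<union> (SIGMA a:Q. {z \<in> H `` {a}. \<not> E a0 z}) \<union> prod.swap ` (SIGMA b:P. {z \<in> H\<inverse> `` {b}. \<not> E b0 z})"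
    (is "_ \<subseteq> ?A \<union> ?B \<union> ?C \<union> ?D \<union> ?F")
  proof (rule subrelI, rule ccontr)
    fix a b assume ab: "(a,b) \<in> H" and "(a,b) \<notin> ?A \<union> ?B \<union> ?C \<union> ?D \<union> ?F"
    then have n: "(a,b) \<notin> ?A" "(a,b) \<notin> ?B" "(a,b) \<notin> ?C" "(a,b) \<notin> ?D" "(a,b) \<notin> ?F" by blast+
    have RA: "a \<notin> RA" using ab n(1) by simp
    have RB: "b \<notin> RB" using ab n(2) by force
    have 1: "\<not> E a0 a" "\<not> E b0 b" "E b0 a \<Longrightarrow> (a,b0) \<in> H" "E a0 b \<Longrightarrow> (a0,b) \<in> H"
      using RA RB ab unfolding RA_def RB_def by auto
    then have "E a0 b \<or> E a b0" using joined[OF e0 ab] by blast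
    moreover have "\<not> (E a b0 \<and> \<not> E a0 b)"
    proof
      assume "E a b0 \<and> \<not> E a0 b"
      with 1 E_sym have "a \<in> Q" unfolding Q_def private_nbrs_def by blast
      with n(4) ab \<open>E a b0 \<and> \<not> E a0 b\<close> show False by simp
    qed
    moreover have "\<not> (E a b0 \<and> E a0 b)"
    proof
      assume "E a b0 \<and> E a0 b"
      with 1 E_sym have "a \<in> Q" "b \<in> P" unfolding Q_def P_def private_nbrs_def by blast+
      with n(3) ab show False by simp
    qed
    moreover have "\<not> (\<not> E a b0 \<and> E a0 b)"
    proof
      assume A: "\<not> E a b0 \<and> E a0 b"
      with 1 have "b \<in> P" unfolding P_def private_nbrs_def by blast
      moreover have "\<not> E b0 a" using A E_sym by blast
      ultimately show False using n(5) ab by force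
    qed
    ultimately show False by blast
  qed
  then have "card H \<le> card (?A \<union> ?B \<union> ?C \<union> ?D \<union> ?F)"
    by (rule card_mono[rotated]) (use fin in \<open>auto simp: RA_def RB_def finite_H\<close>)
  also have "\<dots> \<le> card ?A + card ?B + card ?C + card ?D + card ?F"
    by (meson add_le_mono1 card_Un_le le_trans)
  finally have "real (card H) \<le> card ?A + card ?B + card ?C + card ?D + card ?F" by linarith
  moreover have "real (card ?A) \<le> \<alpha> * card RA"
  proof -
    have "real (card ?A) = (\<Sum>a\<in>RA. real (card (H `` {a})))"
      by (subst card_SigmaI) (auto simp: RA_def)
    also have "\<dots> \<le> (\<Sum>a\<in>RA. \<alpha>)" by (intro sum_mono max)
    finally show ?thesis by (simp add: mult.commute)
  qed
  moreover have "real (card ?B) \<le> \<alpha> * card RB"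
  proof -
    have "card ?B = card (SIGMA b:RB. H\<inverse> `` {b})" by (rule card_image) auto
    then have "real (card ?B) = (\<Sum>b\<in>RB. real (card (H\<inverse> `` {b})))"
      by (simp add: RB_def)
    also have "\<dots> \<le> (\<Sum>b\<in>RB. \<alpha>)" by (intro sum_mono max)
    finally show ?thesis by (simp add: mult.commute)
  qed
  moreover have "real (card RA) + real (card RB) \<le> deg a0 + deg b0 - \<alpha> - q"
  proof -
    have "card RA \<le> card {x \<in> Domain H. E a0 x} + card ({x \<in> Domain H. E b0 x} - H\<inverse> `` {b0})"
      unfolding RA_def by (rule card_Un_le)
    moreover have "card ({x \<in> Domain H. E b0 x} - H\<inverse> `` {b0}) + card (H\<inverse> `` {b0}) = card {x \<in> Domain H. E b0 x}"
      by (subst card_Diff_subset) (use H_E E_sym in \<open>auto intro!: le_add_diff_inverse2 card_mono\<close>)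
    moreover have "card RB \<le> card {x \<in> Range H. E b0 x} + card ({x \<in> Range H. E a0 x} - H `` {a0})"
      unfolding RB_def by (rule card_Un_le)
    moreover have "card ({x \<in> Range H. E a0 x} - H `` {a0}) + card (H `` {a0}) = card {x \<in> Range H. E a0 x}"
      by (subst card_Diff_subset) (use H_E E_sym in \<open>auto intro!: le_add_diff_inverse2 card_mono\<close>)
    moreover have "card {x \<in> Domain H. E a0 x} + card {x \<in> Range H. E a0 x} \<le> deg a0"
      by (rule deg_ge_two_sides) auto
    moreover have "card {x \<in> Domain H. E b0 x} + card {x \<in> Range H. E b0 x} \<le> deg b0"
      by (rule deg_ge_two_sides) auto
    ultimately show ?thesis using \<alpha> unfolding q_def by linarith
  qed
  then have "\<alpha> * (real (card RA) + real (card RB)) \<le> \<alpha> * (deg a0 + deg b0 - \<alpha> - q)"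
    using \<alpha> by (intro mult_left_mono) auto
  moreover have "real (card ?D) = (\<Sum>a\<in>Q. real (u a))"
    using fin by (subst card_SigmaI) (auto simp: u_def)
  moreover have "real (card ?F) = (\<Sum>b\<in>P. real (v b))"
  proof -
    have "card ?F = card (SIGMA b:P. {z \<in> H\<inverse> `` {b}. \<not> E b0 z})" by (rule card_image) auto
    then show ?thesis using fin by (simp add: v_def)
  qed
  moreover have "real (card ?C) = real (card Q) * real (card P)
      - card {(a,b) \<in> Q \<times> P. \<not> E a b} - card {(a,b) \<in> Q \<times> P. E a b \<and> (a,b) \<notin> H}"
  proof -
    have "Q \<times> P = ?C \<union> {(a,b) \<in> Q \<times> P. \<not> E a b} \<union> {(a,b) \<in> Q \<times> P. E a b \<and> (a,b) \<notin> H}"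
      using H_E by blast
    moreover have "card (?C \<union> {(a,b) \<in> Q \<times> P. \<not> E a b} \<union> {(a,b) \<in> Q \<times> P. E a b \<and> (a,b) \<notin> H})
       = card ?C + card {(a,b) \<in> Q \<times> P. \<not> E a b} + card {(a,b) \<in> Q \<times> P. E a b \<and> (a,b) \<notin> H}"
    proof -
      have "finite ?C" "finite {(a,b) \<in> Q \<times> P. \<not> E a b}" "finite {(a,b) \<in> Q \<times> P. E a b \<and> (a,b) \<notin> H}"
        using fin by (auto intro: finite_subset[of _ "Q \<times> P"])
      moreover have "?C \<inter> {(a,b) \<in> Q \<times> P. \<not> E a b} = {}"
          "(?C \<union> {(a,b) \<in> Q \<times> P. \<not> E a b}) \<inter> {(a,b) \<in> Q \<times> P. E a b \<and> (a,b) \<notin> H} = {}"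
        using H_E by auto
      ultimately show ?thesis by (simp add: card_Un_disjoint)
    qed
    ultimately have "card (Q \<times> P) = card ?C + card {(a,b) \<in> Q \<times> P. \<not> E a b} + card {(a,b) \<in> Q \<times> P. E a b \<and> (a,b) \<notin> H}"
      by simp
    then have "real (card (Q \<times> P)) = real (card ?C) + card {(a,b) \<in> Q \<times> P. \<not> E a b} + card {(a,b) \<in> Q \<times> P. E a b \<and> (a,b) \<notin> H}"
      by linarith
    then show ?thesis by (simp add: card_cartesian_product)
  qed
  moreover have "(\<Sum>a\<in>Q. real (u a)) \<le> (\<Sum>a\<in>Q. excess E H a0 b0 a) + card Q * (\<alpha> - card P)"
  proof -
    have "real (u a) \<le> excess E H a0 b0 a + (\<alpha> - card P)" for a
    proof -
      have "card {z \<in> H `` {a0}. E b0 z \<and> (a,z) \<notin> H} + card P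
          = card ({z \<in> H `` {a0}. E b0 z \<and> (a,z) \<notin> H} \<union> P)"
        using fin by (subst card_Un_disjoint) (auto simp: P_def private_nbrs_def)
      also have "\<dots> \<le> card (H `` {a0})" by (rule card_mono) (auto simp: P_def private_nbrs_def)
      finally show ?thesis using \<alpha> unfolding excess_def u_def by linarith
    qed
    then have "(\<Sum>a\<in>Q. real (u a)) \<le> (\<Sum>a\<in>Q. excess E H a0 b0 a + (\<alpha> - card P))" by (intro sum_mono)
    then show ?thesis by (simp add: sum.distrib)
  qed
  moreover have "(\<Sum>b\<in>P. real (v b)) \<le> (\<Sum>b\<in>P. excess E (H\<inverse>) b0 a0 b) + card P * (q - card Q)"
  proof -
    have "real (v b) \<le> excess E (H\<inverse>) b0 a0 b + (q - card Q)" for b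
    proof -
      have "card {z \<in> H\<inverse> `` {b0}. E a0 z \<and> (b,z) \<notin> H\<inverse>} + card Q
          = card ({z \<in> H\<inverse> `` {b0}. E a0 z \<and> (b,z) \<notin> H\<inverse>} \<union> Q)"
        using fin by (subst card_Un_disjoint) (auto simp: Q_def private_nbrs_def)
      also have "\<dots> \<le> card (H\<inverse> `` {b0})" by (rule card_mono) (auto simp: Q_def private_nbrs_def)
      finally show ?thesis unfolding excess_def v_def q_def by linarith
    qed
    then have "(\<Sum>b\<in>P. real (v b)) \<le> (\<Sum>b\<in>P. excess E (H\<inverse>) b0 a0 b + (q - card Q))" by (intro sum_mono)
    then show ?thesis by (simp add: sum.distrib)
  qed
  moreover have "real (card Q) * real (card P) + card Q * (\<alpha> - card P) + card P * (q - card Q) \<le> \<alpha> * q"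
  proof -
    have "real (card Q) \<le> q" unfolding q_def Q_def private_nbrs_def by (auto intro: card_mono)
    moreover have "real (card P) \<le> \<alpha>" unfolding \<alpha>[symmetric] P_def private_nbrs_def by (auto intro: card_mono)
    ultimately have "0 \<le> (q - card Q) * (\<alpha> - card P)" by simp
    then show ?thesis by (simp add: algebra_simps)
  qed
  ultimately show ?thesis by (simp add: algebra_simps)
qed

section \<open>Heavy edges\<close>

text \<open>
  The slack of the Ore condition at \<open>a0 b0\<close> enters both \<open>r\<close> and \<open>s\<close>, so that the degrees of all
  \<open>H\<close>-neighbours of \<open>b0\<close> are at most \<open>\<alpha> + r\<close> and those of \<open>a0\<close> at most \<open>q + s\<close>. This loses nothing,
  as slack also lowers the main term \<open>\<alpha> (d(a0) + d(b0) - \<alpha>)\<close>.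
\<close>

lemma card_le_at_maximum:
  fixes S w c :: real
  assumes wv: "w = 747/1987" and cv: "c = 620/1987"
    and a0: "a0 \<in> Domain H"
    and max: "\<And>x. card (H `` {x}) \<le> card (H `` {a0})" "\<And>y. card (H\<inverse> `` {y}) \<le> card (H `` {a0})"
    and S: "\<And>x y. (x,y) \<in> H \<Longrightarrow> real (deg x + deg y) \<le> S"
    and heavy: "\<And>x y. (x,y) \<in> H \<Longrightarrow> 2 * c * S \<le> real (card (H `` {x}) + card (H\<inverse> `` {y}))"
  shows "real (card H) \<le> c * S\<^sup>2"
proof -
  interpret sw: strong_pairs V E "H\<inverse>" by (rule swap)
  obtain b0 where b0: "(a0,b0) \<in> H"
    and b0_max: "\<And>b. (a0,b) \<in> H \<Longrightarrow> card (H\<inverse> `` {b}) \<le> card (H\<inverse> `` {b0})"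
  proof -
    have "H `` {a0} \<noteq> {}" using a0 by auto
    then obtain b0 where "b0 \<in> H `` {a0}"
        "\<And>b. b \<in> H `` {a0} \<Longrightarrow> card (H\<inverse> `` {b}) \<le> card (H\<inverse> `` {b0})"
      using finite_ex_argmax[of "H `` {a0}" "\<lambda>b. card (H\<inverse> `` {b})"] finite_nbrs(1) by blast
    then show ?thesis using that by blast
  qed
  define \<alpha> where "\<alpha> = real (card (H `` {a0}))"
  define q where "q = real (card (H\<inverse> `` {b0}))"
  define r where "r = S - deg b0 - \<alpha>"
  define s where "s = S - deg a0 - q"
  define Q where "Q = private_nbrs E (H\<inverse>) b0 a0"
  define P where "P = private_nbrs E H a0 b0"
  define N where "N = {(a,b) \<in> Q \<times> P. \<not> E a b}"
  define M where "M = {(a,b) \<in> Q \<times> P. E a b \<and> (a,b) \<notin> H}"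
  define u where "u = excess E H a0 b0"
  define v where "v = excess E (H\<inverse>) b0 a0"
  have fin: "finite Q" "finite P" unfolding Q_def P_def private_nbrs_def by simp_all
  have \<alpha>1: "1 \<le> \<alpha>" unfolding \<alpha>_def using b0 by (simp add: Suc_le_eq card_gt_0_iff) blast
  have deg_a0: "\<alpha> \<le> deg a0" unfolding \<alpha>_def of_nat_le_iff by (rule deg_ge) (use H_E H_V in auto)
  have deg_b0: "q \<le> deg b0" unfolding q_def of_nat_le_iff by (rule deg_ge) (use H_E H_V E_sym in auto)
  have q\<alpha>: "q \<le> \<alpha>" unfolding q_def \<alpha>_def using max(2) by simp
  have q0: "0 \<le> q" by (simp add: q_def)
  have Sab: "deg a0 + deg b0 \<le> S" using S[OF b0] by simp
  then have S0: "0 < S" using \<alpha>1 deg_a0 by linarith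
  have w: "0 < w" using wv by simp
  have "real (card H) \<le> \<alpha> * (deg a0 + deg b0 - \<alpha>) + (sum u Q + sum v P - card N - card M)"
    using card_H_le_excess[OF b0, of \<alpha>] max unfolding \<alpha>_def Q_def P_def u_def v_def N_def M_def by simp
  moreover have "\<alpha> * (deg a0 + deg b0 - \<alpha>) = \<alpha> * (2 * S - 2 * \<alpha> - q - r - s)"
    by (simp add: r_def s_def)
  ultimately have count: "real (card H) \<le> \<alpha> * (2 * S - 2 * \<alpha> - q - r - s) + (sum u Q + sum v P - card N - card M)"
    by (simp only:)
  have QD: "(a,b0) \<in> H" "\<not> E a0 a" if "a \<in> Q" for a using that by (auto simp: Q_def private_nbrs_def)
  have PD: "(a0,b) \<in> H" "\<not> E b0 b" if "b \<in> P" for b using that by (auto simp: P_def private_nbrs_def)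
  have L: "2 * c * S = S - w * S" by (simp add: wv cv)
  have A1: "u a \<le> real (card {b \<in> P. \<not> E a b}) + real (card {b \<in> P. E a b \<and> (a,b) \<notin> H})"
    and A2: "real (card {c \<in> Domain H. E a c}) + u a \<le> real (card {b \<in> P. \<not> E a b}) + r"
    and A3: "real (card {b \<in> P. \<not> E a b}) \<le> w * S"
    and A4: "\<And>b. b \<in> P \<Longrightarrow> \<not> E a b \<Longrightarrow> card {c \<in> H\<inverse> `` {b}. \<not> E b0 c} \<le> card {c \<in> Domain H. E a c}"
    if "a \<in> Q" for a
    using side_facts[OF b0 QD[OF that] max(1) S heavy] unfolding u_def P_def r_def \<alpha>_def L by simp_all
  have heavy': "2 * c * S \<le> real (card (H\<inverse> `` {y}) + card ((H\<inverse>)\<inverse> `` {x}))" if "(y,x) \<in> H\<inverse>" for x y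
    using heavy[of x y] that by simp
  have S': "real (deg y + deg x) \<le> S" if "(y,x) \<in> H\<inverse>" for x y using S[of x y] that by simp
  have B1: "v b \<le> real (card {a \<in> Q. \<not> E b a}) + real (card {a \<in> Q. E b a \<and> (b,a) \<notin> H\<inverse>})"
    and B2: "real (card {c \<in> Range H. E b c}) + v b \<le> real (card {a \<in> Q. \<not> E b a}) + s"
    and B3: "real (card {a \<in> Q. \<not> E b a}) \<le> w * S"
    and B4: "\<And>a. a \<in> Q \<Longrightarrow> \<not> E b a \<Longrightarrow> card {c \<in> H `` {a}. \<not> E a0 c} \<le> card {c \<in> Range H. E b c}"
    if "b \<in> P" for b
  proof -
    have "(b0,a0) \<in> H\<inverse>" "(b,a0) \<in> H\<inverse>" using b0 PD[OF that] by auto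
    note facts = sw.side_facts[OF this PD(2)[OF that] b0_max[OF PD(1)[OF that]] S' heavy']
    show "v b \<le> real (card {a \<in> Q. \<not> E b a}) + real (card {a \<in> Q. E b a \<and> (b,a) \<notin> H\<inverse>})"
      and "real (card {c \<in> Range H. E b c}) + v b \<le> real (card {a \<in> Q. \<not> E b a}) + s"
      and "real (card {a \<in> Q. \<not> E b a}) \<le> w * S"
      and "\<And>a. a \<in> Q \<Longrightarrow> \<not> E b a \<Longrightarrow> card {c \<in> H `` {a}. \<not> E a0 c} \<le> card {c \<in> Range H. E b c}"
      using facts unfolding v_def Q_def s_def q_def L by simp_all
  qed
  have nN: "{b. (a,b) \<in> N} = {b \<in> P. \<not> E a b}" if "a \<in> Q" for a using that by (auto simp: N_def)
  have nM: "{b. (a,b) \<in> M} = {b \<in> P. E a b \<and> (a,b) \<notin> H}" if "a \<in> Q" for a using that by (auto simp: M_def)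
  have mN: "{a. (a,b) \<in> N} = {a \<in> Q. \<not> E b a}" if "b \<in> P" for b using that E_sym by (auto simp: N_def)
  have mM: "{a. (a,b) \<in> M} = {a \<in> Q. E b a \<and> (b,a) \<notin> H\<inverse>}" if "b \<in> P" for b
    using that E_sym by (auto simp: M_def)
  have ND: "a \<in> Q" "b \<in> P" "\<not> E a b" "\<not> E b a" if "(a,b) \<in> N" for a b using that E_sym by (auto simp: N_def)
  have u_le: "u a \<le> card {c \<in> H `` {a}. \<not> E a0 c}" for a by (simp add: u_def excess_def)
  have v_le: "v b \<le> card {c \<in> H\<inverse> `` {b}. \<not> E b0 c}" for b by (simp add: v_def excess_def)
  have excess_bound: "sum u Q + sum v P - card N - card M
      \<le> (card Q * (2 * (w * S) * \<theta> + r)\<^sup>2 + card P * (2 * (w * S) * (1 - \<theta>) + s)\<^sup>2) / (8 * (w * S))"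
    if \<theta>: "0 \<le> \<theta>" "\<theta> \<le> 1" for \<theta>
  proof (rule pair_excess_bound[OF fin _ _ _ \<theta>])
    show "N \<subseteq> Q \<times> P" "M \<subseteq> Q \<times> P" by (auto simp: N_def M_def)
    show "0 < w * S" using w S0 by simp
    show "real (card {b. (a,b) \<in> N}) \<le> w * S" if "a \<in> Q" for a using A3[OF that] nN[OF that] by simp
    show "real (card {a. (a,b) \<in> N}) \<le> w * S" if "b \<in> P" for b using B3[OF that] mN[OF that] by simp
    show "u a \<le> real (card {b. (a,b) \<in> N}) + real (card {b. (a,b) \<in> M})" if "a \<in> Q" for a
      using A1[OF that] nN[OF that] nM[OF that] by simp
    show "v b \<le> real (card {a. (a,b) \<in> N}) + real (card {a. (a,b) \<in> M})" if "b \<in> P" for b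
      using B1[OF that] mN[OF that] mM[OF that] by simp
    show "u a \<le> real (card {b. (a,b) \<in> N}) + r" if "a \<in> Q" for a using A2[OF that] nN[OF that] by simp
    show "v b \<le> real (card {a. (a,b) \<in> N}) + s" if "b \<in> P" for b using B2[OF that] mN[OF that] by simp
    show "u a + v b \<le> real (card {b. (a,b) \<in> N}) + r" if "(a,b) \<in> N" for a b
      using A2[OF ND(1)[OF that]] A4[OF ND(1-3)[OF that]] v_le[of b] nN[OF ND(1)[OF that]] by simp
    show "u a + v b \<le> real (card {a. (a,b) \<in> N}) + s" if "(a,b) \<in> N" for a b
      using B2[OF ND(2)[OF that]] B4[OF ND(2,1,4)[OF that]] u_le[of a] mN[OF ND(2)[OF that]] by simp
  qed
  have "2 * c * S \<le> \<alpha> + q" using heavy[OF b0] by (simp add: \<alpha>_def q_def)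
  then have big: "S - w * S \<le> \<alpha> + q" unfolding L .
  obtain \<theta> where \<theta>: "0 \<le> \<theta>" "\<theta> \<le> 1" and opt: "\<alpha> / S * (2 - 2 * (\<alpha> / S) - q / S - r / S - s / S)
      + (q / S * (2 * w * \<theta> + r / S)\<^sup>2 + \<alpha> / S * (2 * w * (1 - \<theta>) + s / S)\<^sup>2) / (8 * w) \<le> c"
  proof (rule optimal_threshold[OF wv cv])
    have "\<alpha> + q + r \<le> S" "\<alpha> + q + s \<le> S" "S \<le> \<alpha> + q + r + s" "0 \<le> r" "0 \<le> s"
      unfolding r_def s_def using deg_a0 deg_b0 Sab by linarith+
    then show "0 \<le> r / S" "0 \<le> s / S" "\<alpha> / S + q / S + r / S \<le> 1" "\<alpha> / S + q / S + s / S \<le> 1"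
        "1 \<le> \<alpha> / S + q / S + r / S + s / S"
      using S0 by (simp_all add: add_divide_distrib[symmetric])
    show "1 - w \<le> \<alpha> / S + q / S"
      using big S0 by (simp add: add_divide_distrib[symmetric] pos_le_divide_eq left_diff_distrib)
    show "0 \<le> q / S" "q / S \<le> \<alpha> / S" using q0 q\<alpha> S0 by (simp_all add: divide_right_mono)
  qed
  have cQ: "real (card Q) \<le> q" unfolding q_def Q_def private_nbrs_def by (auto intro: card_mono)
  have cP: "real (card P) \<le> \<alpha>" unfolding \<alpha>_def P_def private_nbrs_def by (auto intro: card_mono)
  have "real (card H) \<le> \<alpha> * (2 * S - 2 * \<alpha> - q - r - s)
      + (card Q * (2 * (w * S) * \<theta> + r)\<^sup>2 + card P * (2 * (w * S) * (1 - \<theta>) + s)\<^sup>2) / (8 * (w * S))"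
    using count excess_bound[OF \<theta>] by linarith
  also have "\<dots> \<le> \<alpha> * (2 * S - 2 * \<alpha> - q - r - s)
      + (q * (2 * (w * S) * \<theta> + r)\<^sup>2 + \<alpha> * (2 * (w * S) * (1 - \<theta>) + s)\<^sup>2) / (8 * (w * S))"
    using w S0 cQ cP by (intro add_left_mono divide_right_mono add_mono mult_right_mono) auto
  also have "\<dots> = S\<^sup>2 * (\<alpha> / S * (2 - 2 * (\<alpha> / S) - q / S - r / S - s / S)
      + (q / S * (2 * w * \<theta> + r / S)\<^sup>2 + \<alpha> / S * (2 * w * (1 - \<theta>) + s / S)\<^sup>2) / (8 * w))"
    (is "_ = S\<^sup>2 * ?R")
  proof -
    define x y z t where "x = \<alpha> / S" and "y = q / S" and "z = r / S" and "t = s / S"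
    have e: "\<alpha> = S * x" "q = S * y" "r = S * z" "s = S * t" using S0 by (simp_all add: x_def y_def z_def t_def)
    have "2 * (w * S) * \<theta> + S * z = S * (2 * w * \<theta> + z)"
         "2 * (w * S) * (1 - \<theta>) + S * t = S * (2 * w * (1 - \<theta>) + t)" by (simp_all add: algebra_simps)
    then have "(S * y * (2 * (w * S) * \<theta> + S * z)\<^sup>2 + S * x * (2 * (w * S) * (1 - \<theta>) + S * t)\<^sup>2) / (8 * (w * S))
       = S\<^sup>2 * ((y * (2 * w * \<theta> + z)\<^sup>2 + x * (2 * w * (1 - \<theta>) + t)\<^sup>2) / (8 * w))"
      using S0 w by (simp add: power_mult_distrib) (simp add: field_simps power2_eq_square)
    then show ?thesis unfolding e using S0 by (simp add: distrib_left) (simp add: algebra_simps power2_eq_square)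
  qed
  also have "\<dots> \<le> S\<^sup>2 * c" by (rule mult_left_mono[OF opt]) simp
  finally show ?thesis by (simp add: mult.commute)
qed

lemma card_le_if_heavy:
  fixes S c :: real
  assumes cv: "c = 620/1987"
    and S: "\<And>x y. (x,y) \<in> H \<Longrightarrow> real (deg x + deg y) \<le> S"
    and heavy: "\<And>x y. (x,y) \<in> H \<Longrightarrow> 2 * c * S \<le> real (card (H `` {x}) + card (H\<inverse> `` {y}))"
  shows "real (card H) \<le> c * S\<^sup>2"
proof (cases "H = {}")
  case True
  then show ?thesis by (simp add: cv)
next
  case False
  interpret sw: strong_pairs V E "H\<inverse>" by (rule swap)
  have ne: "Domain H \<noteq> {}" "Range H \<noteq> {}" using False by auto
  obtain a0 where a0: "a0 \<in> Domain H" "\<And>x. x \<in> Domain H \<Longrightarrow> card (H `` {x}) \<le> card (H `` {a0})"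
    using finite_ex_argmax[OF finite_nbrs(3) ne(1), of "\<lambda>x. card (H `` {x})"] by blast
  obtain b0 where b0: "b0 \<in> Range H" "\<And>y. y \<in> Range H \<Longrightarrow> card (H\<inverse> `` {y}) \<le> card (H\<inverse> `` {b0})"
    using finite_ex_argmax[OF finite_nbrs(4) ne(2), of "\<lambda>y. card (H\<inverse> `` {y})"] by blast
  have A: "card (H `` {x}) \<le> card (H `` {a0})" for x
  proof (cases "x \<in> Domain H")
    case False
    then have "H `` {x} = {}" by auto
    then show ?thesis by simp
  qed (rule a0(2))
  have B: "card (H\<inverse> `` {y}) \<le> card (H\<inverse> `` {b0})" for y
  proof (cases "y \<in> Range H")
    case False
    then have "H\<inverse> `` {y} = {}" by auto
    then show ?thesis by simp
  qed (rule b0(2))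
  show ?thesis
  proof (cases "card (H\<inverse> `` {b0}) \<le> card (H `` {a0})")
    case True
    show ?thesis
      by (rule card_le_at_maximum[OF refl cv a0(1) A order_trans[OF B True] S heavy])
  next
    case False
    then have A': "card ((H\<inverse>)\<inverse> `` {x}) \<le> card (H\<inverse> `` {b0})" for x using A[of x] by simp
    have S': "real (deg x + deg y) \<le> S" if "(x,y) \<in> H\<inverse>" for x y using S[of y x] that by simp
    have heavy': "2 * c * S \<le> real (card (H\<inverse> `` {x}) + card ((H\<inverse>)\<inverse> `` {y}))" if "(x,y) \<in> H\<inverse>" for x y
      using heavy[of y x] that by simp
    have "b0 \<in> Domain (H\<inverse>)" using b0(1) by simp
    then have "real (card (H\<inverse>)) \<le> c * S\<^sup>2"
      by (rule sw.card_le_at_maximum[OF refl cv _ B A' S' heavy'])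
    then show ?thesis by simp
  qed
qed

section \<open>Deleting light edges, and blowing up\<close>

lemma delete_edge:
  assumes "(a,b) \<in> H"
  defines "H' \<equiv> {(x,y) \<in> H. x \<noteq> a \<and> y \<noteq> b}"
  shows "strong_pairs (V - {a,b}) E H'"
    and "\<And>x y. (x,y) \<in> H' \<Longrightarrow> card {z \<in> V - {a,b}. E x z} + card {z \<in> V - {a,b}. E y z} + 1 \<le> deg x + deg y"
    and "card H + 1 \<le> card H' + card (H `` {a}) + card (H\<inverse> `` {b})"
proof -
  have noteq: "x \<noteq> b" "y \<noteq> a" if "(x,y) \<in> H" for x y using that assms(1) sides_disjoint by auto
  show "strong_pairs (V - {a,b}) E H'"
  proof
    show "Domain H' \<inter> Range H' = {}" using sides_disjoint by (auto simp: H'_def)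
    show "H' \<subseteq> (V - {a,b}) \<times> (V - {a,b})" using H_V noteq unfolding H'_def by blast
  qed (use finite_V E_sym H_E joined in \<open>auto simp: H'_def\<close>)
  show "card {z \<in> V - {a,b}. E x z} + card {z \<in> V - {a,b}. E y z} + 1 \<le> deg x + deg y"
    if "(x,y) \<in> H'" for x y
  proof -
    have ab: "a \<in> V" "b \<in> V" using assms(1) H_V by auto
    have le: "card {z \<in> V - {a,b}. E t z} \<le> deg t" for t
      unfolding deg_def by (rule card_mono) (use finite_V in auto)
    have less: "card {z \<in> V - {a,b}. E t z} < deg t" if "E t a \<or> E t b" for t
      unfolding deg_def by (rule psubset_card_mono) (use finite_V ab that in auto)
    have "E x a \<or> E x b \<or> E y a \<or> E y b"
      using joined[OF assms(1), of x y] that E_sym by (auto simp: H'_def)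
    then show ?thesis using le[of x] le[of y] less[of x] less[of y] by linarith
  qed
  define A where "A = Pair a ` (H `` {a})"
  define B where "B = (\<lambda>x. (x,b)) ` (H\<inverse> `` {b})"
  have fin: "finite A" "finite B" by (auto simp: A_def B_def)
  have "H = H' \<union> (A \<union> B)" by (auto simp: H'_def A_def B_def)
  then have "card H \<le> card H' + card (A \<union> B)" using card_Un_le[of H' "A \<union> B"] by simp
  moreover have "card (A \<union> B) + card (A \<inter> B) = card A + card B" by (rule card_Un_Int[OF fin, symmetric])
  moreover have "1 \<le> card (A \<inter> B)"
  proof -
    have "(a,b) \<in> A \<inter> B" using assms(1) by (auto simp: A_def B_def)
    then have "card (A \<inter> B) \<noteq> 0" using fin(1) by (metis card_0_eq empty_iff finite_Int)
    then show ?thesis by simp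
  qed
  moreover have "card A = card (H `` {a})" unfolding A_def by (rule card_image) (auto simp: inj_on_def)
  moreover have "card B = card (H\<inverse> `` {b})" unfolding B_def by (rule card_image) (auto simp: inj_on_def)
  ultimately show "card H + 1 \<le> card H' + card (H `` {a}) + card (H\<inverse> `` {b})" by linarith
qed

end

text \<open>
  The bound \<open>f(S) = c S\<^sup>2 + c S\<close> is chosen so that \<open>f(S) - f(S - 1) = 2 c S\<close>, exactly what the
  deletion of a light edge may cost.
\<close>

lemma card_le_with_linear_error:
  fixes c :: real and S :: nat
  assumes cv: "c = 620/1987" and "strong_pairs V E H"
    and "\<And>x y. (x,y) \<in> H \<Longrightarrow> card {z \<in> V. E x z} + card {z \<in> V. E y z} \<le> S"
  shows "real (card H) \<le> c * (real S)\<^sup>2 + c * S"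
  using assms(2,3)
proof (induction S arbitrary: V H)
  case 0
  interpret strong_pairs V E H by fact
  have "H = {}"
  proof (rule equals0I, clarify)
    fix x y assume xy: "(x,y) \<in> H"
    then have "y \<in> {z \<in> V. E x z}" using H_E H_V by auto
    moreover have "finite {z \<in> V. E x z}" using finite_V by simp
    ultimately show False using "0.prems"(2)[OF xy] by auto
  qed
  then show ?case by simp
next
  case (Suc S)
  interpret strong_pairs V E H by fact
  have deg: "deg x + deg y \<le> Suc S" if "(x,y) \<in> H" for x y using Suc.prems(2)[OF that] by (simp add: deg_def)
  show ?case
  proof (cases "\<forall>(x,y) \<in> H. 2 * c * Suc S \<le> real (card (H `` {x}) + card (H\<inverse> `` {y}))")
    case True
    then have "real (card H) \<le> c * (real (Suc S))\<^sup>2"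
      using deg by (intro card_le_if_heavy[OF cv]) (auto simp only: of_nat_le_iff)
    moreover have "0 \<le> c * real (Suc S)" using cv by simp
    ultimately show ?thesis by linarith
  next
    case False
    then obtain a b where ab: "(a,b) \<in> H" and light: "real (card (H `` {a}) + card (H\<inverse> `` {b})) < 2 * c * Suc S"
      by force
    define H' where "H' = {(x,y) \<in> H. x \<noteq> a \<and> y \<noteq> b}"
    note del = delete_edge[OF ab, folded H'_def]
    have "real (card H') \<le> c * (real S)\<^sup>2 + c * S"
    proof (rule Suc.IH[OF del(1)])
      fix x y assume xy: "(x,y) \<in> H'"
      then have "(x,y) \<in> H" by (simp add: H'_def)
      then show "card {z \<in> V - {a,b}. E x z} + card {z \<in> V - {a,b}. E y z} \<le> S"
        using del(2)[OF xy] deg by fastforce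
    qed
    then have "real (card H) \<le> c * (real S)\<^sup>2 + c * S + 2 * c * Suc S"
      using del(3) light by linarith
    also have "\<dots> = c * (real (Suc S))\<^sup>2 + c * Suc S" by (simp add: power2_eq_square algebra_simps)
    finally show ?thesis .
  qed
qed

lemma blow_up:
  fixes k :: nat
  assumes "strong_pairs V E H"
  defines "H' \<equiv> (\<lambda>((x,y),(i,j)). ((x,i),(y,j))) ` (H \<times> ({..<k} \<times> {..<k}))"
  shows "strong_pairs (V \<times> {..<k}) (\<lambda>p q. E (fst p) (fst q)) H'"
proof -
  interpret strong_pairs V E H by fact
  have mem: "(fst p, fst q) \<in> H" "snd p < k" "snd q < k" if "(p,q) \<in> H'" for p q
    using that unfolding H'_def by auto
  show ?thesis
  proof
    show "finite (V \<times> {..<k})" using finite_V by simp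
    show "H' \<subseteq> (V \<times> {..<k}) \<times> (V \<times> {..<k})" unfolding H'_def using H_V by auto
    show "Domain H' \<inter> Range H' = {}"
    proof (rule equals0I)
      fix p assume "p \<in> Domain H' \<inter> Range H'"
      then have "fst p \<in> Domain H \<inter> Range H" using mem(1) by blast
      then show False using sides_disjoint by simp
    qed
    show "E (fst x) (fst y) \<Longrightarrow> E (fst y) (fst x)" for x y :: "'a \<times> nat" by (rule E_sym)
    show "E (fst x) (fst y)" if "(x,y) \<in> H'" for x y using H_E mem(1)[OF that] .
    show "E (fst a) (fst a') \<or> E (fst b) (fst b') \<or> E (fst a) (fst b') \<or> E (fst a') (fst b)"
      if "(a,b) \<in> H'" "(a',b') \<in> H'" for a b a' b'
      using joined[OF mem(1)[OF that(1)] mem(1)[OF that(2)]] .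
  qed
qed

text \<open>
  In a blow-up by \<open>k\<close> the linear error is divided by \<open>k\<close> relative to the other terms.
\<close>

theorem card_strong_pairs_le:
  fixes c :: real and S :: nat
  assumes cv: "c = 620/1987" and sp: "strong_pairs V E H"
    and S: "\<And>x y. (x,y) \<in> H \<Longrightarrow> card {z \<in> V. E x z} + card {z \<in> V. E y z} \<le> S"
  shows "real (card H) \<le> c * (real S)\<^sup>2"
proof -
  have approx: "real (card H) \<le> c * (real S)\<^sup>2 + c * S / Suc n" for n
  proof -
    define k where "k = Suc n"
    define H' where "H' = (\<lambda>((x,y),(i,j)). ((x,i),(y,j))) ` (H \<times> ({..<k} \<times> {..<k}))"
    have deg: "card {p \<in> V \<times> {..<k}. E x (fst p)} = k * card {z \<in> V. E x z}" for x
    proof -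
      have "{p \<in> V \<times> {..<k}. E x (fst p)} = {z \<in> V. E x z} \<times> {..<k}" by auto
      then show ?thesis by (simp add: card_cartesian_product)
    qed
    have "real (card H') \<le> c * (real (k * S))\<^sup>2 + c * (k * S)"
    proof (rule card_le_with_linear_error[OF cv])
      show "strong_pairs (V \<times> {..<k}) (\<lambda>p q. E (fst p) (fst q)) H'" unfolding H'_def by (rule blow_up[OF sp])
      fix x y assume "(x,y) \<in> H'"
      then have "(fst x, fst y) \<in> H" by (auto simp: H'_def)
      from S[OF this] have "k * (card {z \<in> V. E (fst x) z} + card {z \<in> V. E (fst y) z}) \<le> k * S" by (rule mult_le_mono2)
      then show "card {z \<in> V \<times> {..<k}. E (fst x) (fst z)} + card {z \<in> V \<times> {..<k}. E (fst y) (fst z)} \<le> k * S"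
        unfolding deg by (simp add: distrib_left)
    qed
    moreover have "card H' = card H * (k * k)"
      unfolding H'_def by (subst card_image) (auto simp: inj_on_def card_cartesian_product)
    moreover have k: "real k > 0" by (simp add: k_def)
    then have "c * (real (k * S))\<^sup>2 + c * (k * S) = (c * (real S)\<^sup>2 + c * S / k) * (real k * real k)"
      by (simp add: field_simps power2_eq_square)
    ultimately have "real (card H) * (real k * real k) \<le> (c * (real S)\<^sup>2 + c * S / k) * (real k * real k)"
      by simp
    then show ?thesis using k unfolding k_def[symmetric] by (simp add: mult_le_cancel_right)
  qed
  show ?thesis
  proof (rule LIMSEQ_le_const)
    have "(\<lambda>n. c * S / Suc n) \<longlonglongrightarrow> 0"
      using tendsto_mult_right_zero[OF LIMSEQ_inverse_real_of_nat, of "c * S"] by (simp add: divide_inverse)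
    then show "(\<lambda>n. c * (real S)\<^sup>2 + c * S / Suc n) \<longlonglongrightarrow> c * (real S)\<^sup>2"
      using tendsto_add[OF tendsto_const] by fastforce
  qed (use approx in blast)
qed

section \<open>Strong cliques in the line graph\<close>

lemma adjacent_commute: "adjacent G x y \<longleftrightarrow> adjacent G y x"
  by (simp add: adjacent_def insert_commute)

lemma line_graph_adjacent:
  "adjacent (line_graph G) e f \<Longrightarrow> e \<in> gedges G \<and> f \<in> gedges G \<and> e \<inter> f \<noteq> {}"
  unfolding adjacent_def line_graph_def by (auto simp: doubleton_eq_iff)

lemma short_walk:
  assumes "is_walk F x p y" "length p \<le> 3"
  shows "x = y \<or> adjacent F x y \<or> (\<exists>z. adjacent F x z \<and> adjacent F z y)"
proof -
  have adj: "adjacent F (p ! i) (p ! Suc i)" if "Suc i < length p" for i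
    using assms(1) that by (auto simp: is_walk_def)
  have ends: "p \<noteq> []" "x = p ! 0" "y = p ! (length p - 1)"
    using assms(1) by (auto simp: is_walk_def hd_conv_nth last_conv_nth)
  consider "length p = 1" | "length p = 2" | "length p = 3"
    using assms(2) ends(1) by (cases "length p") (auto simp: le_Suc_eq numeral_3_eq_3)
  then show ?thesis
  proof cases
    case 3
    then have "adjacent F (p ! 0) (p ! 1)" "adjacent F (p ! 1) (p ! 2)" using adj[of 0] adj[of 1] by (auto simp: numeral_2_eq_2)
    then show ?thesis using ends 3 by auto
  qed (use adj[of 0] ends in auto)
qed

lemma graph_dist_le_two:
  assumes "graph_dist F x y \<le> enat 2"
  shows "\<exists>p. is_walk F x p y \<and> length p \<le> 3"
proof (rule ccontr)
  assume "\<not> ?thesis"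
  then have "enat 3 \<le> graph_dist F x y" unfolding graph_dist_def by (intro INF_greatest) force
  then have "enat 3 \<le> enat 2" using assms by (rule order_trans)
  then show False by simp
qed

lemma strong_clique_joined:
  assumes G: "finite_simple_graph G"
    and ef: "adjacent (graph_power (line_graph G) 2) e f"
  shows "e \<inter> f \<noteq> {} \<or> (\<exists>x\<in>e. \<exists>y\<in>f. adjacent G x y)"
proof -
  have close: "e \<inter> f \<noteq> {} \<or> (\<exists>x\<in>e. \<exists>y\<in>f. adjacent G x y)"
    if d: "graph_dist (line_graph G) e f \<le> enat 2" and e: "e \<in> gedges G" for e f
  proof -
    obtain p where p: "is_walk (line_graph G) e p f" "length p \<le> 3" using graph_dist_le_two[OF d] by blast
    consider "e = f" | "adjacent (line_graph G) e f"
      | z where "adjacent (line_graph G) e z" "adjacent (line_graph G) z f"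
      using short_walk[OF p] by blast
    then show ?thesis
    proof cases
      case 1
      then show ?thesis using e G by (auto simp: finite_simple_graph_def)
    next
      case 2
      then show ?thesis using line_graph_adjacent[of G e f] by blast
    next
      case 3
      then have z: "z \<in> gedges G" "e \<inter> z \<noteq> {}" "z \<inter> f \<noteq> {}" using line_graph_adjacent[OF 3(1)] line_graph_adjacent[OF 3(2)] by auto
      obtain s t where "z = {s,t}" using G z(1) unfolding finite_simple_graph_def by blast
      moreover from this have "adjacent G s t" "adjacent G t s" using z(1) by (auto simp: adjacent_def insert_commute)
      ultimately show ?thesis using z(2,3) by blast
    qed
  qed
  have "e \<in> gedges G" "f \<in> gedges G"
      "graph_dist (line_graph G) e f \<le> enat 2 \<or> graph_dist (line_graph G) f e \<le> enat 2"
    using ef unfolding adjacent_def graph_power_def by (auto simp: doubleton_eq_iff line_graph_def)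
  then show ?thesis using close[of e f] close[of f e] adjacent_commute[of G] by blast
qed

theorem theorem1p6:
  fixes G H :: "'a sgraph"
  assumes "finite_simple_graph G"
    and "is_subgraph H G"
    and "bipartite_graph H"
    and "is_clique (graph_power (line_graph G) 2) (gedges H)"
  shows "real (card (gedges H)) \<le> 620 / 1987 * (real (ore_degree G H))\<^sup>2"
proof -
  obtain A B where AB: "A \<union> B = gverts H" "A \<inter> B = {}"
    and bip: "\<forall>e \<in> gedges H. \<exists>a\<in>A. \<exists>b\<in>B. e = {a,b}"
    using assms(3) unfolding bipartite_graph_def by (elim exE conjE)
  define V where "V = gverts G"
  define P where "P = {(a,b). a \<in> A \<and> b \<in> B \<and> {a,b} \<in> gedges H}"
  have sub: "gverts H \<subseteq> V" "gedges H \<subseteq> gedges G" using assms(2) by (auto simp: is_subgraph_def V_def)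
  have finV: "finite V" using assms(1) by (simp add: finite_simple_graph_def V_def)
  have PV: "P \<subseteq> V \<times> V" using AB(1) sub(1) by (auto simp: P_def)
  have img: "(\<lambda>(a,b). {a,b}) ` P = gedges H"
  proof
    show "gedges H \<subseteq> (\<lambda>(a,b). {a,b}) ` P"
    proof
      fix e assume e: "e \<in> gedges H"
      then obtain a b where "a \<in> A" "b \<in> B" "e = {a,b}" using bip by blast
      then have "(a,b) \<in> P" using e by (simp add: P_def)
      then show "e \<in> (\<lambda>(a,b). {a,b}) ` P" using \<open>e = {a,b}\<close> by force
    qed
  qed (auto simp: P_def)
  have inj: "inj_on (\<lambda>(a,b). {a,b}) P" using AB(2) by (auto simp: inj_on_def P_def doubleton_eq_iff)
  have card: "card P = card (gedges H)" using card_image[OF inj] img by simp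
  have sp: "strong_pairs V (adjacent G) P"
  proof
    show "adjacent G a a' \<or> adjacent G b b' \<or> adjacent G a b' \<or> adjacent G a' b"
      if "(a,b) \<in> P" "(a',b') \<in> P" for a b a' b'
    proof -
      have e: "{a,b} \<in> gedges H" "{a',b'} \<in> gedges H" using that by (auto simp: P_def)
      then have ab: "adjacent G a b" "adjacent G a' b'" using sub by (auto simp: adjacent_def)
      show ?thesis
      proof (cases "{a,b} \<inter> {a',b'} = {}")
        case True
        then have "adjacent (graph_power (line_graph G) 2) {a,b} {a',b'}"
          using assms(4) e unfolding is_clique_def by blast
        then show ?thesis using strong_clique_joined[OF assms(1)] True
          unfolding adjacent_def by (fastforce simp: insert_commute)
      next
        case False
        then show ?thesis using ab that AB(2) by (auto simp: P_def adjacent_def insert_commute)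
      qed
    qed
    show "Domain P \<inter> Range P = {}" using AB(2) by (auto simp: P_def)
    show "adjacent G a b" if "(a,b) \<in> P" for a b using that sub by (auto simp: P_def adjacent_def)
  qed (use finV PV in \<open>auto simp: adjacent_def insert_commute\<close>)
  have "real (card P) \<le> 620 / 1987 * (real (ore_degree G H))\<^sup>2"
  proof (rule card_strong_pairs_le[OF refl sp])
    fix x y assume "(x,y) \<in> P"
    then have xy: "{x,y} \<in> gedges H" by (simp add: P_def)
    define D where "D = {vertex_degree G x + vertex_degree G y | x y. {x, y} \<in> gedges H}"
    have "D \<subseteq> (\<lambda>(x,y). vertex_degree G x + vertex_degree G y) ` (V \<times> V)"
    proof
      fix d assume "d \<in> D"
      then obtain x y where "{x,y} \<in> gedges H" "d = vertex_degree G x + vertex_degree G y" by (auto simp: D_def)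
      moreover from this have "x \<in> V" "y \<in> V" using bspec[OF bip, of "{x,y}"] AB(1) sub(1) by (auto simp: doubleton_eq_iff)
      ultimately show "d \<in> (\<lambda>(x,y). vertex_degree G x + vertex_degree G y) ` (V \<times> V)" by auto
    qed
    then have "finite D" using finV by (meson finite_SigmaI finite_imageI finite_subset)
    then have "vertex_degree G x + vertex_degree G y \<le> Max D" using xy by (intro Max_ge) (auto simp: D_def)
    then show "card {z \<in> V. adjacent G x z} + card {z \<in> V. adjacent G y z} \<le> ore_degree G H"
      using xy by (auto simp: ore_degree_def vertex_degree_def V_def D_def)
  qed
  then show ?thesis using card by simp
qed

end
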